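(* Let $u$ and $v$ be inner functions on the open unit disk. Then $D_u$ is unitarily equivalent to $D_v$ if and only if $|u(0)|=|v(0)|$.
   Context: $L^2=L^2(\mathbb{T},dm)$, where $\mathbb{T}$ is the unit circle and $m$ is normalized Lebesgue measure, and $H^2=\{f\in L^2:\widehat f(n)=0\ \forall n<0\}$ is the Hardy space. For an inner function $u$, $\mathcal{K}_u=H^2\cap(uH^2)^{\perp}$, $P_u$ is the orthogonal projection of $L^2$ onto $\mathcal{K}_u$, and $\mathcal{K}_u^{\perp}$ is the orthogonal complement of $\mathcal{K}_u$ in $L^2$. The dual of the compressed shift is $D_u:\mathcal{K}_u^{\perp}\to\mathcal{K}_u^{\perp}$, $D_uf=(I-P_u)(zf)$. *)

theory Defs
  imports "HOL-Complex_Analysis.Complex_Analysis"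
begin

section \<open>The space \<open>L\<^sup>2\<close> of the unit circle\<close>

definition circle_measure :: "complex measure" where
  "circle_measure =
     distr (uniform_measure lborel {0..<2 * pi}) (restrict_space borel (sphere 0 1)) cis"

definition square_integrable :: "(complex \<Rightarrow> complex) \<Rightarrow> bool" where
  "square_integrable f \<longleftrightarrow>
     f \<in> borel_measurable circle_measure \<and> integrable circle_measure (\<lambda>z. (norm (f z))\<^sup>2)"

lemma space_circle_measure: "space circle_measure = sphere 0 1"
  by (simp add: circle_measure_def space_restrict_space)

lemma sets_circle_measure:
  "sets circle_measure = sets (restrict_space borel (sphere 0 1))"
  by (simp add: circle_measure_def)

lemma measurable_ident_circle: "(\<lambda>z. z) \<in> borel_measurable circle_measure"
proof -
  have "(\<lambda>z::complex. z) \<in> measurable (restrict_space borel (sphere 0 1)) borel"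
    by (intro measurable_restrict_space1) simp
  then show ?thesis
    by (simp add: measurable_cong_sets[OF sets_circle_measure refl])
qed

lemma borel_measurable_cnj_comp:
  "f \<in> borel_measurable M \<Longrightarrow> (\<lambda>z. cnj (f z)) \<in> borel_measurable M"
  by (rule measurable_compose[of f M borel cnj borel])
     (auto intro!: borel_measurable_continuous_onI continuous_intros)

lemma square_integrable_zero: "square_integrable (\<lambda>_. 0)"
  by (simp add: square_integrable_def)

lemma square_integrable_add:
  assumes "square_integrable f" "square_integrable g"
  shows "square_integrable (\<lambda>z. f z + g z)"
proof -
  have [measurable]: "f \<in> borel_measurable circle_measure" "g \<in> borel_measurable circle_measure"
    using assms by (auto simp: square_integrable_def)
  have le: "(norm (a + b))\<^sup>2 \<le> 2 * (norm a)\<^sup>2 + 2 * (norm b)\<^sup>2" for a b :: complex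
  proof -
    have "(norm (a + b))\<^sup>2 \<le> (norm a + norm b)\<^sup>2"
      by (intro power_mono norm_triangle_ineq) auto
    also have "\<dots> \<le> 2 * (norm a)\<^sup>2 + 2 * (norm b)\<^sup>2"
      using sum_squares_bound[of "norm a" "norm b"] by (simp add: power2_sum)
    finally show ?thesis .
  qed
  have "integrable circle_measure (\<lambda>z. 2 * (norm (f z))\<^sup>2 + 2 * (norm (g z))\<^sup>2)"
    using assms by (auto simp: square_integrable_def)
  then have "integrable circle_measure (\<lambda>z. (norm (f z + g z))\<^sup>2)"
    by (rule Bochner_Integration.integrable_bound) (auto intro!: AE_I2 order_trans[OF le])
  then show ?thesis
    by (simp add: square_integrable_def)
qed

lemma square_integrable_scale:
  assumes "square_integrable f"
  shows "square_integrable (\<lambda>z. c * f z)"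
  using assms by (auto simp: square_integrable_def norm_mult power_mult_distrib)

lemma square_integrable_uminus:
  assumes "square_integrable f"
  shows "square_integrable (\<lambda>z. - f z)"
  using assms by (auto simp: square_integrable_def)

lemma square_integrable_times_ident:
  assumes "square_integrable f"
  shows "square_integrable (\<lambda>z. z * f z)"
proof -
  have [measurable]: "f \<in> borel_measurable circle_measure"
    "(\<lambda>z. z) \<in> borel_measurable circle_measure"
    using assms measurable_ident_circle by (auto simp: square_integrable_def)
  have "integrable circle_measure (\<lambda>z. (norm (z * f z))\<^sup>2) \<longleftrightarrow>
        integrable circle_measure (\<lambda>z. (norm (f z))\<^sup>2)"
    by (rule Bochner_Integration.integrable_cong)
       (auto simp: space_circle_measure norm_mult)
  then show ?thesis
    using assms by (simp add: square_integrable_def)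
qed

quotient_type L2 = "complex \<Rightarrow> complex" / partial:
  "\<lambda>f g. square_integrable f \<and> square_integrable g \<and> (AE z in circle_measure. f z = g z)"
proof (rule part_equivpI)
  show "\<exists>f. square_integrable f \<and> square_integrable f \<and> (AE z in circle_measure. f z = f z)"
    using square_integrable_zero by auto
  show "symp (\<lambda>f g. square_integrable f \<and> square_integrable g \<and>
    (AE z in circle_measure. f z = g z))"
    by (auto simp: symp_def elim!: eventually_mono)
  show "transp (\<lambda>f g. square_integrable f \<and> square_integrable g \<and>
    (AE z in circle_measure. f z = g z))"
    unfolding transp_def by (auto elim: eventually_elim2)
qed

instantiation L2 :: ab_group_add
begin

lift_definition zero_L2 :: L2 is "\<lambda>_. 0"
  by (simp add: square_integrable_zero)

lift_definition plus_L2 :: "L2 \<Rightarrow> L2 \<Rightarrow> L2" is "\<lambda>f g z. f z + g z"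
  by (auto intro!: square_integrable_add elim!: eventually_elim2)

lift_definition uminus_L2 :: "L2 \<Rightarrow> L2" is "\<lambda>f z. - f z"
  by (auto intro!: square_integrable_uminus)

definition minus_L2 :: "L2 \<Rightarrow> L2 \<Rightarrow> L2" where
  "minus_L2 f g = f + - g"

instance
proof
  fix a b c :: L2
  show "a + b + c = a + (b + c)"
    by transfer (auto simp: add.assoc intro!: square_integrable_add)
  show "a + b = b + a"
    by transfer (auto simp: add.commute intro!: square_integrable_add)
  show "0 + a = a"
    by transfer simp
  show "- a + a = 0"
    by transfer (auto simp: square_integrable_zero)
  show "a - b = a + - b"
    by (rule minus_L2_def)
qed

end

lift_definition scaleC_L2 :: "complex \<Rightarrow> L2 \<Rightarrow> L2" is "\<lambda>c f z. c * f z"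
  by (auto intro!: square_integrable_scale)

lift_definition cinner_L2 :: "L2 \<Rightarrow> L2 \<Rightarrow> complex" is
  "\<lambda>f g. \<integral>z. f z * cnj (g z) \<partial>circle_measure"
  by (intro integral_cong_AE)
     (auto simp: square_integrable_def intro!: borel_measurable_times borel_measurable_cnj_comp
        elim!: eventually_elim2)

lemma fourier_coeff_cong_AE:
  assumes *: "square_integrable f \<and> square_integrable g \<and> (AE z in circle_measure. f z = g z)"
  shows "(\<integral>z. f z * cnj (z powi n) \<partial>circle_measure) = (\<integral>z. g z * cnj (z powi n) \<partial>circle_measure)"
proof -
  have [measurable]: "f \<in> borel_measurable circle_measure" "g \<in> borel_measurable circle_measure"
    using * by (auto simp: square_integrable_def)
  have [measurable]: "(\<lambda>z. cnj (z powi n)) \<in> borel_measurable circle_measure"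
    by (cases "n \<ge> 0")
       (auto simp: power_int_def intro!: borel_measurable_cnj_comp borel_measurable_power
          borel_measurable_inverse measurable_ident_circle)
  show ?thesis
  proof (rule integral_cong_AE)
    show "(\<lambda>z. f z * cnj (z powi n)) \<in> borel_measurable circle_measure"
      "(\<lambda>z. g z * cnj (z powi n)) \<in> borel_measurable circle_measure"
      by measurable
    show "AE z in circle_measure. f z * cnj (z powi n) = g z * cnj (z powi n)"
      using * by (auto elim!: eventually_mono)
  qed
qed

lift_definition fourier_coeff :: "L2 \<Rightarrow> int \<Rightarrow> complex" is
  "\<lambda>f n. \<integral>z. f z * cnj (z powi n) \<partial>circle_measure"
  by (intro ext fourier_coeff_cong_AE)

lift_definition mult_z :: "L2 \<Rightarrow> L2" is "\<lambda>f z. z * f z"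
  by (auto intro!: square_integrable_times_ident)

text \<open>For an arbitrary function \<open>\<phi>\<close> the product \<open>\<phi> f\<close> need not be in \<open>L\<^sup>2\<close>, so multiplication
  by \<open>\<phi>\<close> is the relation \<open>g = \<phi> f\<close> almost everywhere.\<close>

lift_definition is_product :: "(complex \<Rightarrow> complex) \<Rightarrow> L2 \<Rightarrow> L2 \<Rightarrow> bool" is
  "\<lambda>\<phi> f g. AE z in circle_measure. g z = \<phi> z * f z"
proof -
  fix \<phi> f f' g g' :: "complex \<Rightarrow> complex"
  assume "square_integrable f \<and> square_integrable f' \<and> (AE z in circle_measure. f z = f' z)"
     and "square_integrable g \<and> square_integrable g' \<and> (AE z in circle_measure. g z = g' z)"
  then have "AE z in circle_measure. f z = f' z \<and> g z = g' z"
    by auto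
  then have "AE z in circle_measure. (g z = \<phi> z * f z) = (g' z = \<phi> z * f' z)"
    by (rule eventually_mono) auto
  then show "(AE z in circle_measure. g z = \<phi> z * f z) = (AE z in circle_measure. g' z = \<phi> z * f' z)"
    by (rule eventually_subst)
qed

section \<open>Orthogonality and unitary equivalence\<close>

definition orth_compl :: "L2 set \<Rightarrow> L2 set" where
  "orth_compl S = {f. \<forall>g\<in>S. cinner_L2 f g = 0}"

text \<open>The description below determines the projection uniquely when \<open>S\<close> is a closed subspace.\<close>

definition orth_proj :: "L2 set \<Rightarrow> L2 \<Rightarrow> L2" where
  "orth_proj S f = (THE g. g \<in> S \<and> f - g \<in> orth_compl S)"

definition unitary_between :: "L2 set \<Rightarrow> L2 set \<Rightarrow> (L2 \<Rightarrow> L2) \<Rightarrow> bool" where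
  "unitary_between H K U \<longleftrightarrow>
     bij_betw U H K \<and>
     (\<forall>f\<in>H. \<forall>g\<in>H. U (f + g) = U f + U g) \<and>
     (\<forall>c. \<forall>f\<in>H. U (scaleC_L2 c f) = scaleC_L2 c (U f)) \<and>
     (\<forall>f\<in>H. \<forall>g\<in>H. cinner_L2 (U f) (U g) = cinner_L2 f g)"

text \<open>Unitary equivalence of \<open>A : H \<rightarrow> H\<close> and \<open>B : K \<rightarrow> K\<close>; the values of \<open>A\<close> off \<open>H\<close> and
  of \<open>B\<close> off \<open>K\<close> play no role.\<close>

definition unitarily_equivalent ::
  "L2 set \<Rightarrow> (L2 \<Rightarrow> L2) \<Rightarrow> L2 set \<Rightarrow> (L2 \<Rightarrow> L2) \<Rightarrow> bool" where
  "unitarily_equivalent H A K B \<longleftrightarrow>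
     (\<exists>U. unitary_between H K U \<and> (\<forall>f\<in>H. U (A f) = B (U f)))"

section \<open>Inner functions, model spaces and the dual of the compressed shift\<close>

text \<open>Unimodular constants count as inner functions.\<close>

definition inner_function :: "(complex \<Rightarrow> complex) \<Rightarrow> bool" where
  "inner_function u \<longleftrightarrow>
     u holomorphic_on ball 0 1 \<and> bounded (u ` ball 0 1) \<and>
     (AE z in circle_measure.
        \<exists>l. ((\<lambda>r. u (of_real r * z)) \<longlongrightarrow> l) (at_left (1::real)) \<and> norm l = 1)"

definition boundary_fun :: "(complex \<Rightarrow> complex) \<Rightarrow> complex \<Rightarrow> complex" where
  "boundary_fun u z = Lim (at_left (1::real)) (\<lambda>r. u (of_real r * z))"

definition hardy2 :: "L2 set" where
  "hardy2 = {f. \<forall>n<0. fourier_coeff f n = 0}"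

definition inner_times_hardy2 :: "(complex \<Rightarrow> complex) \<Rightarrow> L2 set" where
  "inner_times_hardy2 u = {g. \<exists>h\<in>hardy2. is_product (boundary_fun u) h g}"

definition model_space :: "(complex \<Rightarrow> complex) \<Rightarrow> L2 set" where
  "model_space u = hardy2 \<inter> orth_compl (inner_times_hardy2 u)"

definition dual_compressed_shift :: "(complex \<Rightarrow> complex) \<Rightarrow> L2 \<Rightarrow> L2" where
  "dual_compressed_shift u f = mult_z f - orth_proj (model_space u) (mult_z f)"

end

theory Submission
  imports Defs
begin

text \<open>The complement of \<open>K\<^sub>u\<close> splits as \<open>u H\<^sup>2\<close> plus the complement of \<open>H\<^sup>2\<close>, with orthonormal basis
  \<open>u z\<^sup>n\<close> for \<open>n \<ge> 0\<close> and \<open>z\<^sup>n\<close> for \<open>n < 0\<close>. In this basis \<open>D\<^sub>u\<close> is the bilateral shift with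
  all weights \<open>1\<close> except that \<open>z\<^bsup>-1\<^esup>\<close> goes to \<open>cnj (u 0) u\<close>, because the projection of \<open>1\<close> onto
  \<open>u H\<^sup>2\<close> is \<open>cnj (u 0) u\<close>. Rotating the basis vectors with \<open>n \<ge> 0\<close> changes the argument of the
  exceptional weight arbitrarily. Its modulus is a unitary invariant: it is the minimum of
  \<open>norm (D\<^sub>u f)\<close> over unit vectors \<open>f\<close>, attained at \<open>z\<^bsup>-1\<^esup>\<close>.\<close>

section \<open>Integration over the circle\<close>

text \<open>The basis serves only as a picture: computations use vectors
  \<open>inner_mult u h + g\<close> with \<open>h\<close> in \<open>hardy2\<close> and
  \<open>g\<close> in \<open>conj_hardy2\<close>. Bringing an arbitrary vector of the complement
  into this form takes an orthogonal projection onto \<open>hardy2\<close>. Since \<open>L2\<close>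
  is given as a bare quotient, two classical facts have to come before it: completeness of the
  space, so that the series over nonnegative frequencies converges, and completeness of the
  trigonometric system, so that coefficients determine a vector. The inner function enters through
  two properties of its boundary values. They are unimodular, so multiplication by them is unitary;
  and their integral against \<open>z ^ k\<close> is \<open>u 0\<close> for \<open>k = 0\<close> and
  0 for larger \<open>k\<close>. It follows that 1 projects onto the model space as
  \<open>1 - cnj (u 0) * u\<close>, the reproducing kernel at 0. This gives the identity behind the
  invariant: passing from \<open>f\<close> to its image under the operator lowers the squared norm
  by exactly \<open>(norm c)\<^sup>2 * (1 - (norm (u 0))\<^sup>2)\<close>, where \<open>c\<close> is
  the coefficient of \<open>f\<close> at frequency -1. As \<open>norm c\<close> is at most
  \<open>norm f\<close>, the minimum can be read off.\<close>

lemma measurable_cis_circle: "cis \<in> borel \<rightarrow>\<^sub>M restrict_space borel (sphere 0 1)"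
  by (intro measurable_restrict_space2 borel_measurable_continuous_onI continuous_intros) auto

text \<open>Finiteness puts constants into \<open>L2\<close> and lets them dominate in limit
  theorems; \<open>circle.density_zero\<close> comes from it too.\<close>

interpretation circle: finite_measure circle_measure
proof
  have "emeasure circle_measure (space circle_measure) =
      emeasure (uniform_measure lborel {0..<2 * pi}) (cis -` sphere 0 1 \<inter> UNIV)"
    unfolding space_circle_measure circle_measure_def
    by (subst emeasure_distr)
       (use measurable_cis_circle in \<open>auto simp: measurable_def sets_restrict_space\<close>)
  also have "cis -` sphere 0 1 \<inter> UNIV = UNIV" by auto
  finally show "emeasure circle_measure (space circle_measure) \<noteq> \<infinity>"
    by (auto simp: divide_ennreal)
qed

lemma measurable_circle_continuous:
  assumes "continuous_on (sphere 0 1) f"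
  shows "f \<in> borel_measurable circle_measure"
  using borel_measurable_continuous_on_restrict[OF assms]
  by (simp add: measurable_cong_sets[OF sets_circle_measure refl])

text \<open>Bridge from the abstract measure to a gauge integral over the angle, the form in which
  contour integrals are available. Closing the half-open interval adds only the null set consisting
  of \<open>2 * pi\<close>.\<close>

lemma integral_circle:
  fixes g :: "complex \<Rightarrow> complex"
  assumes "continuous_on (sphere 0 1) g"
  shows "(\<integral>z. g z \<partial>circle_measure) = integral {0..2 * pi} (\<lambda>t. g (cis t)) / (2 * pi)"
proof -
  define A where "A = {0..<2 * pi}"
  note cis = measurable_cis_circle
  have gr: "g \<in> borel_measurable (restrict_space borel (sphere 0 1))"
    by (rule borel_measurable_continuous_on_restrict[OF assms])
  have gcis: "(\<lambda>t. g (cis t)) \<in> borel_measurable borel"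
    using measurable_compose[OF cis gr] .
  have cont: "continuous_on {0..2 * pi} (\<lambda>t. g (cis t))"
    by (rule continuous_on_compose2[OF assms]) (auto intro!: continuous_intros)
  have um: "uniform_measure lborel A = density lborel (\<lambda>t. ennreal (indicator A t / (2 * pi)))"
    unfolding uniform_measure_def A_def
    by (intro density_cong) (auto simp: ennreal_divide_numeral divide_ennreal indicator_def
          simp flip: ennreal_1 intro!: AE_I2)
  have "(\<integral>z. g z \<partial>circle_measure) = (\<integral>t. g (cis t) \<partial>uniform_measure lborel A)"
    unfolding circle_measure_def A_def
    by (intro integral_distr) (use cis gr in \<open>auto simp: measurable_def\<close>)
  also have "\<dots> = (\<integral>t. (indicator A t / (2 * pi)) *\<^sub>R g (cis t) \<partial>lborel)"
    unfolding um by (intro integral_density) (use gcis in \<open>auto simp: A_def\<close>)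
  also have "\<dots> = (\<integral>t. (1 / (2 * pi)) *\<^sub>R (indicator {0..2 * pi} t *\<^sub>R g (cis t)) \<partial>lborel)"
  proof (rule integral_cong_AE)
    show "AE t in lborel. (indicator A t / (2 * pi)) *\<^sub>R g (cis t) =
            (1 / (2 * pi)) *\<^sub>R (indicator {0..2 * pi} t *\<^sub>R g (cis t))"
      using AE_lborel_singleton[of "2 * pi"]
      by eventually_elim (auto simp: A_def indicator_def)
  qed (use gcis in \<open>auto simp: A_def\<close>)
  also have "\<dots> = (1 / (2 * pi)) *\<^sub>R (LINT t:{0..2 * pi}|lborel. g (cis t))"
    unfolding set_lebesgue_integral_def by (rule integral_scaleR_right)
  also have "(LINT t:{0..2 * pi}|lborel. g (cis t)) = integral {0..2 * pi} (\<lambda>t. g (cis t))"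
    by (rule set_borel_integral_eq_integral(2)[OF borel_integrable_atLeastAtMost'[OF cont]])
  finally show ?thesis
    by (simp add: scaleR_conv_of_real)
qed

text \<open>Mean value property, read off from Cauchy's formula: on the unit circle
  \<open>dw / w\<close> is \<open>\<i> dt\<close>, so the quotient by \<open>w\<close> leaves just
  \<open>f (cis t)\<close>.\<close>

lemma integral_circle_holomorphic:
  assumes "f holomorphic_on cball 0 1"
  shows "(\<integral>z. f z \<partial>circle_measure) = f 0"
proof -
  have "((\<lambda>w. f w / (w - 0)) has_contour_integral (2 * of_real pi * \<i> * f 0)) (circlepath 0 1)"
    by (rule Cauchy_integral_circlepath_simple) (use assms in auto)
  then have "((\<lambda>t. \<i> * f (cis t)) has_integral (2 * of_real pi * \<i> * f 0)) {0..2 * pi}"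
    unfolding circlepath_def
    by (subst (asm) has_contour_integral_part_circlepath_iff) (auto simp: mult_ac)
  \<comment> \<open>The factor \<open>- \<i>\<close> removes the \<open>\<i>\<close> contributed by
    the parametrization.\<close>
  then have "((\<lambda>t. - \<i> * (\<i> * f (cis t))) has_integral (- \<i> * (2 * of_real pi * \<i> * f 0))) {0..2 * pi}"
    by (rule has_integral_mult_right)
  then have "integral {0..2 * pi} (\<lambda>t. f (cis t)) = 2 * of_real pi * f 0"
    by (auto simp: algebra_simps dest: integral_unique)
  moreover have "continuous_on (sphere 0 1) f"
    using holomorphic_on_imp_continuous_on[OF assms] by (rule continuous_on_subset) auto
  ultimately show ?thesis
    by (simp add: integral_circle)
qed

section \<open>\<open>L\<^sup>2\<close> as a Hilbert space\<close>

lemma square_integrable_rep_L2: "square_integrable (rep_L2 f)"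
  using Quotient3_rep_reflp[OF Quotient3_L2] by blast

lemma abs_rep_L2 [simp]: "abs_L2 (rep_L2 f) = f"
  by (rule Quotient3_abs_rep[OF Quotient3_L2])

lemma rep_abs_L2:
  assumes "square_integrable f"
  shows "AE z in circle_measure. rep_L2 (abs_L2 f) z = f z"
  using rep_abs_rsp_left[OF Quotient3_L2, of f f] assms by simp

lemma L2_eq_iff: "f = g \<longleftrightarrow> (AE z in circle_measure. rep_L2 f z = rep_L2 g z)"
  using Quotient3_rel_rep[OF Quotient3_L2, of f g] square_integrable_rep_L2 by auto

lemma measurable_rep_L2 [measurable]: "rep_L2 f \<in> borel_measurable circle_measure"
  using square_integrable_rep_L2[of f] by (simp add: square_integrable_def)

lemma rep_zero_L2: "AE z in circle_measure. rep_L2 0 z = 0"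
  unfolding zero_L2_def by (rule rep_abs_L2[OF square_integrable_zero])

lemma rep_plus_L2: "AE z in circle_measure. rep_L2 (f + g) z = rep_L2 f z + rep_L2 g z"
  unfolding plus_L2_def
  by (auto intro!: rep_abs_L2 square_integrable_add square_integrable_rep_L2)

lemma rep_uminus_L2: "AE z in circle_measure. rep_L2 (- f) z = - rep_L2 f z"
  unfolding uminus_L2_def
  by (auto intro!: rep_abs_L2 square_integrable_uminus square_integrable_rep_L2)

lemma rep_minus_L2: "AE z in circle_measure. rep_L2 (f - g) z = rep_L2 f z - rep_L2 g z"
  using rep_plus_L2[of f "- g"] rep_uminus_L2[of g]
  unfolding minus_L2_def by eventually_elim simp

lemma rep_scaleC_L2: "AE z in circle_measure. rep_L2 (scaleC_L2 c f) z = c * rep_L2 f z"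
  unfolding scaleC_L2_def
  by (auto intro!: rep_abs_L2 square_integrable_scale square_integrable_rep_L2)

lemma cinner_L2_rep: "cinner_L2 f g = (\<integral>z. rep_L2 f z * cnj (rep_L2 g z) \<partial>circle_measure)"
  unfolding cinner_L2_def by simp

lemma fourier_coeff_rep: "fourier_coeff f n = (\<integral>z. rep_L2 f z * cnj (z powi n) \<partial>circle_measure)"
  unfolding fourier_coeff_def by simp

lemma integrable_mult_cnj:
  assumes "square_integrable f" "square_integrable g"
  shows "integrable circle_measure (\<lambda>z. f z * cnj (g z))"
proof -
  have [measurable]: "f \<in> borel_measurable circle_measure" "(\<lambda>z. cnj (g z)) \<in> borel_measurable circle_measure"
    using assms by (auto simp: square_integrable_def intro: borel_measurable_cnj_comp)
  have le: "norm (a * cnj b) \<le> (norm a)\<^sup>2 + (norm b)\<^sup>2" for a b :: complex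
  proof -
    have "2 * norm a * norm b \<le> (norm a)\<^sup>2 + (norm b)\<^sup>2"
      by (rule sum_squares_bound)
    moreover have "0 \<le> norm a * norm b" by simp
    ultimately have "norm a * norm b \<le> (norm a)\<^sup>2 + (norm b)\<^sup>2" by linarith
    then show ?thesis by (simp add: norm_mult)
  qed
  have "integrable circle_measure (\<lambda>z. (norm (f z))\<^sup>2 + (norm (g z))\<^sup>2)"
    using assms by (auto simp: square_integrable_def)
  then show ?thesis
    by (rule Bochner_Integration.integrable_bound) (use le in \<open>auto intro!: AE_I2 order_trans[OF le]\<close>)
qed

lemma integrable_rep_cnj: "integrable circle_measure (\<lambda>z. rep_L2 f z * cnj (rep_L2 g z))"
  by (intro integrable_mult_cnj square_integrable_rep_L2)

lemma measurable_cnj_rep [measurable]: "(\<lambda>z. cnj (rep_L2 f z)) \<in> borel_measurable circle_measure"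
  by (intro borel_measurable_cnj_comp measurable_rep_L2)

lemma cinner_add_left: "cinner_L2 (f + g) h = cinner_L2 f h + cinner_L2 g h"
proof -
  have "cinner_L2 (f + g) h =
      (\<integral>z. rep_L2 f z * cnj (rep_L2 h z) + rep_L2 g z * cnj (rep_L2 h z) \<partial>circle_measure)"
    unfolding cinner_L2_rep
  proof (rule integral_cong_AE)
    show "AE z in circle_measure. rep_L2 (f + g) z * cnj (rep_L2 h z) =
        rep_L2 f z * cnj (rep_L2 h z) + rep_L2 g z * cnj (rep_L2 h z)"
      using rep_plus_L2[of f g] by eventually_elim (simp add: algebra_simps)
  qed auto
  then show ?thesis
    by (simp add: cinner_L2_rep integrable_rep_cnj)
qed

lemma cinner_scaleC_left: "cinner_L2 (scaleC_L2 c f) g = c * cinner_L2 f g"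
proof -
  have "cinner_L2 (scaleC_L2 c f) g = (\<integral>z. c * (rep_L2 f z * cnj (rep_L2 g z)) \<partial>circle_measure)"
    unfolding cinner_L2_rep
  proof (rule integral_cong_AE)
    show "AE z in circle_measure. rep_L2 (scaleC_L2 c f) z * cnj (rep_L2 g z) =
        c * (rep_L2 f z * cnj (rep_L2 g z))"
      using rep_scaleC_L2[of c f] by eventually_elim simp
  qed auto
  then show ?thesis
    by (simp add: cinner_L2_rep)
qed

lemma cinner_commute: "cinner_L2 f g = cnj (cinner_L2 g f)"
proof -
  have "cnj (cinner_L2 g f) = (\<integral>z. cnj (rep_L2 g z * cnj (rep_L2 f z)) \<partial>circle_measure)"
    unfolding cinner_L2_rep by (rule Bochner_Integration.integral_cnj[symmetric])
  then show ?thesis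
    unfolding cinner_L2_rep by (simp add: mult.commute)
qed

lemma cinner_self: "cinner_L2 f f = of_real (\<integral>z. (norm (rep_L2 f z))\<^sup>2 \<partial>circle_measure)"
proof -
  have "cinner_L2 f f = (\<integral>z. of_real ((norm (rep_L2 f z))\<^sup>2) \<partial>circle_measure)"
    unfolding cinner_L2_rep by (simp only: complex_norm_square)
  then show ?thesis by (simp only: integral_complex_of_real)
qed

lemma cinner_self_eq_zero: "cinner_L2 f f = 0 \<longleftrightarrow> f = 0"
proof -
  have "cinner_L2 f f = 0 \<longleftrightarrow> (AE z in circle_measure. (norm (rep_L2 f z))\<^sup>2 = 0)"
    unfolding cinner_self of_real_eq_0_iff
    using square_integrable_rep_L2[of f]
    by (intro integral_nonneg_eq_0_iff_AE) (auto simp: square_integrable_def)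
  also have "\<dots> \<longleftrightarrow> (AE z in circle_measure. rep_L2 f z = rep_L2 0 z)"
  proof -
    have "AE z in circle_measure. ((norm (rep_L2 f z))\<^sup>2 = 0) = (rep_L2 f z = rep_L2 0 z)"
      using rep_zero_L2 by eventually_elim auto
    then show ?thesis by (rule eventually_subst)
  qed
  finally show ?thesis by (simp add: L2_eq_iff)
qed

lemma scaleC_add_right: "scaleC_L2 c (f + g) = scaleC_L2 c f + scaleC_L2 c g"
  unfolding L2_eq_iff
  using rep_scaleC_L2[of c "f + g"] rep_plus_L2[of f g] rep_plus_L2[of "scaleC_L2 c f" "scaleC_L2 c g"]
    rep_scaleC_L2[of c f] rep_scaleC_L2[of c g]
  by eventually_elim (simp add: algebra_simps)

lemma scaleC_add_left: "scaleC_L2 (c + d) f = scaleC_L2 c f + scaleC_L2 d f"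
  unfolding L2_eq_iff
  using rep_scaleC_L2[of "c + d" f] rep_plus_L2[of "scaleC_L2 c f" "scaleC_L2 d f"]
    rep_scaleC_L2[of c f] rep_scaleC_L2[of d f]
  by eventually_elim (simp add: algebra_simps)

lemma scaleC_scaleC [simp]: "scaleC_L2 c (scaleC_L2 d f) = scaleC_L2 (c * d) f"
  unfolding L2_eq_iff
  using rep_scaleC_L2[of c "scaleC_L2 d f"] rep_scaleC_L2[of d f] rep_scaleC_L2[of "c * d" f]
  by eventually_elim simp

lemma scaleC_one [simp]: "scaleC_L2 1 f = f"
  unfolding L2_eq_iff using rep_scaleC_L2[of 1 f] by eventually_elim simp

text \<open>The real part of \<open>cinner_L2\<close> induces the same norm, because
  \<open>cinner_L2 f f\<close> is real. The class then supplies Cauchy-Schwarz, the Pythagorean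
  theorem and the theory of series; complex scalars are handled separately through
  \<open>scaleC_L2\<close>.\<close>

instantiation L2 :: real_inner
begin

definition "scaleR r (f::L2) = scaleC_L2 (of_real r) f"
definition "inner (f::L2) g = Re (cinner_L2 f g)"
definition "norm (f::L2) = sqrt (inner f f)"
definition "sgn (f::L2) = inverse (norm f) *\<^sub>R f"
definition "dist (f::L2) g = norm (f - g)"
definition "(uniformity :: (L2 \<times> L2) filter) = (INF e\<in>{0<..}. principal {(f, g). dist f g < e})"
definition "open (S :: L2 set) \<longleftrightarrow>
  (\<forall>f\<in>S. eventually (\<lambda>(f', g). f' = f \<longrightarrow> g \<in> S) uniformity)"

instance
proof
  fix a b :: real and f g h :: L2 and S :: "L2 set"
  show "dist f g = norm (f - g)" by (rule dist_L2_def)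
  show "a *\<^sub>R (f + g) = a *\<^sub>R f + a *\<^sub>R g"
    "(a + b) *\<^sub>R f = a *\<^sub>R f + b *\<^sub>R f" "a *\<^sub>R b *\<^sub>R f = (a * b) *\<^sub>R f" "1 *\<^sub>R f = f"
    by (simp_all add: scaleR_L2_def scaleC_add_left scaleC_add_right)
  show "sgn f = inverse (norm f) *\<^sub>R f" by (rule sgn_L2_def)
  show "(uniformity :: (L2 \<times> L2) filter) = (INF e\<in>{0<..}. principal {(f, g). dist f g < e})"
    by (rule uniformity_L2_def)
  show "open S \<longleftrightarrow> (\<forall>f\<in>S. eventually (\<lambda>(f', g). f' = f \<longrightarrow> g \<in> S) uniformity)"
    by (rule open_L2_def)
  show "inner f g = inner g f"
    unfolding inner_L2_def by (subst cinner_commute) simp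
  show "inner (f + g) h = inner f h + inner g h"
    by (simp add: inner_L2_def cinner_add_left)
  show "inner (a *\<^sub>R f) g = a * inner f g"
    by (simp add: inner_L2_def scaleR_L2_def cinner_scaleC_left)
  show "0 \<le> inner f f"
    by (simp add: inner_L2_def cinner_self)
  show "inner f f = 0 \<longleftrightarrow> f = 0"
    using cinner_self_eq_zero[of f] by (simp add: inner_L2_def cinner_self)
  show "norm f = sqrt (inner f f)" by (rule norm_L2_def)
qed

end

lemma cinner_self_norm: "cinner_L2 f f = of_real ((norm f)\<^sup>2)"
  by (simp add: power2_norm_eq_inner inner_L2_def cinner_self)

lemma norm_L2_eq_integral: "(norm f)\<^sup>2 = (\<integral>z. (norm (rep_L2 f z))\<^sup>2 \<partial>circle_measure)"
  by (simp add: power2_norm_eq_inner inner_L2_def cinner_self)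

lemma cinner_add_right: "cinner_L2 f (g + h) = cinner_L2 f g + cinner_L2 f h"
  by (metis cinner_add_left cinner_commute complex_cnj_add)

lemma cinner_scaleC_right: "cinner_L2 f (scaleC_L2 c g) = cnj c * cinner_L2 f g"
  by (metis cinner_commute cinner_scaleC_left complex_cnj_mult)

lemma cinner_zero [simp]: "cinner_L2 0 g = 0" "cinner_L2 g 0 = 0"
  using cinner_add_left[of 0 0 g] cinner_add_right[of g 0 0] by simp_all

lemma uminus_eq_scaleC: "- f = scaleC_L2 (-1) f"
  unfolding L2_eq_iff using rep_uminus_L2[of f] rep_scaleC_L2[of "-1" f]
  by eventually_elim simp

lemma cinner_diff_left: "cinner_L2 (f - g) h = cinner_L2 f h - cinner_L2 g h"
  unfolding diff_conv_add_uminus[of f g] cinner_add_left uminus_eq_scaleC[of g] cinner_scaleC_left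
  by simp

lemma cinner_diff_right: "cinner_L2 h (f - g) = cinner_L2 h f - cinner_L2 h g"
  unfolding diff_conv_add_uminus[of f g] cinner_add_right uminus_eq_scaleC[of g] cinner_scaleC_right
  by simp

lemma norm_scaleC_L2: "norm (scaleC_L2 c f) = norm c * norm f"
proof -
  have "(norm (scaleC_L2 c f))\<^sup>2 = (norm c * norm f)\<^sup>2"
  proof -
    have "complex_of_real ((norm (scaleC_L2 c f))\<^sup>2) = (c * cnj c) * complex_of_real ((norm f)\<^sup>2)"
      by (simp only: cinner_self_norm[symmetric] cinner_scaleC_left cinner_scaleC_right mult_ac)
    also have "\<dots> = complex_of_real ((norm c * norm f)\<^sup>2)"
      by (simp add: complex_norm_square[symmetric] power_mult_distrib)
    finally show ?thesis unfolding of_real_eq_iff .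
  qed
  then show ?thesis by simp
qed

text \<open>Multiplying \<open>f\<close> by the conjugate phase \<open>w\<close> of the inner
  product makes that product real and nonnegative, which reduces the claim to the real
  Cauchy-Schwarz inequality.\<close>

lemma norm_cinner_le: "norm (cinner_L2 f g) \<le> norm f * norm g"
proof (cases "cinner_L2 f g = 0")
  case False
  define w where "w = cnj (sgn (cinner_L2 f g))"
  have w: "norm w = 1" using False by (simp add: w_def norm_sgn)
  have "w * cinner_L2 f g = cnj (cinner_L2 f g) * cinner_L2 f g / of_real (norm (cinner_L2 f g))"
    by (simp add: w_def sgn_eq)
  also have "\<dots> = of_real (norm (cinner_L2 f g))"
    using False by (simp add: complex_norm_square[symmetric] mult.commute power2_eq_square)
  finally have "w * cinner_L2 f g = of_real (norm (cinner_L2 f g))" .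
  then have "norm (cinner_L2 f g) = inner (scaleC_L2 w f) g"
    by (simp add: inner_L2_def cinner_scaleC_left)
  also have "\<dots> \<le> norm (scaleC_L2 w f) * norm g"
    by (rule norm_cauchy_schwarz)
  finally show ?thesis by (simp add: norm_scaleC_L2 w)
qed simp

lemma bounded_linear_cinner_left: "bounded_linear (\<lambda>f. cinner_L2 f g)"
proof (rule bounded_linear_intro)
  show "cinner_L2 (r *\<^sub>R x) g = r *\<^sub>R cinner_L2 x g" for r x
    by (simp add: scaleR_L2_def cinner_scaleC_left scaleR_conv_of_real)
  show "norm (cinner_L2 x g) \<le> norm x * norm g" for x
    by (rule norm_cinner_le)
qed (rule cinner_add_left)

section \<open>Completeness of \<open>L2\<close>\<close>

lemma nn_integral_rep_L2:
  "(\<integral>\<^sup>+z. ennreal ((norm (rep_L2 f z))\<^sup>2) \<partial>circle_measure) = ennreal ((norm f)\<^sup>2)"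
  unfolding norm_L2_eq_integral
  using square_integrable_rep_L2[of f]
  by (intro nn_integral_eq_integral) (auto simp: square_integrable_def)

text \<open>Turns the output of Fatou's lemma, a bound on a nonnegative integral, into membership in
  \<open>L2\<close> together with a norm bound.\<close>

lemma square_integrableI_nn_integral:
  assumes h: "h \<in> borel_measurable circle_measure" and "0 \<le> c"
    and le: "(\<integral>\<^sup>+z. ennreal ((norm (h z))\<^sup>2) \<partial>circle_measure) \<le> ennreal c"
  shows "square_integrable h" and "(norm (abs_L2 h))\<^sup>2 \<le> c"
proof -
  have "integrable circle_measure (\<lambda>z. (norm (h z))\<^sup>2)"
    unfolding integrable_iff_bounded using h le by (auto intro: le_less_trans)
  then show sq: "square_integrable h"
    using h by (simp add: square_integrable_def)
  have "ennreal ((norm (abs_L2 h))\<^sup>2) = (\<integral>\<^sup>+z. ennreal ((norm (h z))\<^sup>2) \<partial>circle_measure)"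
    unfolding nn_integral_rep_L2[symmetric]
    by (rule nn_integral_cong_AE) (use rep_abs_L2[OF sq] in eventually_elim, simp)
  with le \<open>0 \<le> c\<close> show "(norm (abs_L2 h))\<^sup>2 \<le> c"
    by (metis ennreal_le_iff)
qed

lemma Cauchy_fast_subsequence:
  fixes X :: "nat \<Rightarrow> 'a::metric_space"
  assumes "Cauchy X"
  obtains r where "\<And>j. j \<le> r j" "\<And>j. dist (X (r (Suc j))) (X (r j)) < (1/2) ^ j"
proof -
  have "\<exists>M. \<forall>m\<ge>M. \<forall>n\<ge>M. dist (X m) (X n) < (1/2) ^ j" for j :: nat
    using assms unfolding Cauchy_def by simp
  then obtain M where M: "\<And>j m n. m \<ge> M j \<Longrightarrow> n \<ge> M j \<Longrightarrow> dist (X m) (X n) < (1/2) ^ j"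
    by metis
  \<comment> \<open>Summing the thresholds up to \<open>j\<close> makes both \<open>r j\<close> and
    \<open>r (Suc j)\<close> exceed \<open>M j\<close>, without assuming \<open>M\<close> monotone;
    the summand \<open>j\<close> gives \<open>j \<le> r j\<close>.\<close>
  define r where "r j = j + (\<Sum>i\<le>j. M i)" for j
  have "M j \<le> r j" "M j \<le> r (Suc j)" for j
    by (simp_all add: r_def lessThan_Suc_atMost[symmetric])
  then show ?thesis
    by (intro that[of r] M) (auto simp: r_def)
qed

text \<open>A rapidly converging subsequence converges almost everywhere; Fatou's lemma then shows
  that its pointwise limit \<open>G\<close> is square integrable and is the norm limit of the whole
  sequence.\<close>

lemma Riesz_Fischer:
  fixes X :: "nat \<Rightarrow> L2"
  assumes "Cauchy X"
  shows "convergent X"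
proof -
  obtain r where r: "\<And>j. j \<le> r j" "\<And>j. dist (X (r (Suc j))) (X (r j)) < (1/2) ^ j"
    using Cauchy_fast_subsequence[OF assms] by blast
  define g where "g j = rep_L2 (X (r j))" for j
  have g[measurable]: "g j \<in> borel_measurable circle_measure" for j
    by (simp add: g_def)
  \<comment> \<open>The weight \<open>2 ^ j\<close> is a compromise: the squared distance is below
    \<open>(1/4) ^ j\<close>, so the integrals of \<open>h j\<close> are still summable, yet
    \<open>h j\<close> plus a geometric term controls the unsquared difference.\<close>
  define h where "h j z = 2 ^ j * (norm (g (Suc j) z - g j z))\<^sup>2" for j z
  have h[measurable]: "h j \<in> borel_measurable circle_measure" for j
    unfolding h_def by measurable
  have int_h: "(\<integral>\<^sup>+z. ennreal (h j z) \<partial>circle_measure) \<le> ennreal ((1/2) ^ j)" for j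
  proof -
    have "(\<integral>\<^sup>+z. ennreal (h j z) \<partial>circle_measure) =
        (\<integral>\<^sup>+z. ennreal (2 ^ j) * ennreal ((norm (rep_L2 (X (r (Suc j)) - X (r j)) z))\<^sup>2) \<partial>circle_measure)"
      by (rule nn_integral_cong_AE)
         (use rep_minus_L2[of "X (r (Suc j))" "X (r j)"] in eventually_elim,
           simp add: h_def g_def ennreal_mult)
    also have "\<dots> = ennreal (2 ^ j) * ennreal ((norm (X (r (Suc j)) - X (r j)))\<^sup>2)"
      by (subst nn_integral_cmult) (auto simp: nn_integral_rep_L2)
    also have "\<dots> = ennreal (2 ^ j * (norm (X (r (Suc j)) - X (r j)))\<^sup>2)"
      by (simp add: ennreal_mult)
    also have "\<dots> \<le> ennreal ((1/2) ^ j)"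
    proof (rule ennreal_leI)
      have "(norm (X (r (Suc j)) - X (r j)))\<^sup>2 \<le> ((1/2) ^ j)\<^sup>2"
        using r(2)[of j] by (intro power_mono) (auto simp: dist_norm)
      then have "2 ^ j * (norm (X (r (Suc j)) - X (r j)))\<^sup>2 \<le> 2 ^ j * ((1/2) ^ j)\<^sup>2"
        by (intro mult_left_mono) auto
      then show "2 ^ j * (norm (X (r (Suc j)) - X (r j)))\<^sup>2 \<le> (1/2) ^ j"
        by (simp add: power2_eq_square power_one_over)
    qed
    finally show ?thesis .
  qed
  have "(\<integral>\<^sup>+z. (\<Sum>j. ennreal (h j z)) \<partial>circle_measure) = (\<Sum>j. \<integral>\<^sup>+z. ennreal (h j z) \<partial>circle_measure)"
    by (rule nn_integral_suminf) measurable
  also have "\<dots> \<le> (\<Sum>j. ennreal ((1/2) ^ j))"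
    by (intro suminf_le int_h) auto
  also have "\<dots> = ennreal (\<Sum>j. (1/2) ^ j)"
    by (rule suminf_ennreal2) auto
  finally have "(\<integral>\<^sup>+z. (\<Sum>j. ennreal (h j z)) \<partial>circle_measure) \<noteq> \<infinity>"
    by (auto simp: top_unique)
  then have "AE z in circle_measure. (\<Sum>j. ennreal (h j z)) \<noteq> \<infinity>"
    by (intro nn_integral_PInf_AE) auto
  then have "AE z in circle_measure. convergent (\<lambda>j. g j z)"
  proof eventually_elim
    case (elim z)
    \<comment> \<open>A difference \<open>a\<close> above \<open>(1/2) ^ j\<close> satisfies
      \<open>1 \<le> 2 ^ j * a\<close>, hence \<open>a \<le> 2 ^ j * a\<^sup>2\<close>.\<close>
    have le: "norm (g (Suc j) z - g j z) \<le> h j z + (1/2) ^ j" for j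
    proof (cases "norm (g (Suc j) z - g j z) \<le> (1/2) ^ j")
      case False
      define a where "a = norm (g (Suc j) z - g j z)"
      have "1 \<le> 2 ^ j * a" using False by (simp add: a_def field_simps power_one_over)
      then have "1 * a \<le> (2 ^ j * a) * a" by (intro mult_right_mono) (auto simp: a_def)
      then have "a \<le> h j z" by (simp add: h_def a_def power2_eq_square mult.assoc)
      then show ?thesis unfolding a_def by (rule order_trans) simp
    qed (simp add: h_def add_increasing)
    have "summable (\<lambda>j. h j z)"
      by (rule summable_suminf_not_top) (use elim in \<open>auto simp: h_def\<close>)
    then have "summable (\<lambda>j. h j z + (1/2) ^ j)"
      by (intro summable_add) auto
    then have "summable (\<lambda>j. g (Suc j) z - g j z)"
      by (rule summable_comparison_test') (use le in auto)
    then have "convergent (\<lambda>n. (\<Sum>j<n. g (Suc j) z - g j z))"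
      by (simp add: summable_iff_convergent)
    then have "convergent (\<lambda>n. (g n z - g 0 z) + g 0 z)"
      by (intro convergent_add convergent_const) (simp add: sum_lessThan_telescope[of "\<lambda>j. g j z"])
    then show ?case by simp
  qed
  define G where "G z = lim (\<lambda>j. g j z)" for z
  have G[measurable]: "G \<in> borel_measurable circle_measure"
    unfolding G_def by measurable
  have lim: "AE z in circle_measure. (\<lambda>j. g j z) \<longlonglongrightarrow> G z"
    using \<open>AE z in circle_measure. convergent (\<lambda>j. g j z)\<close>
    by eventually_elim (simp add: G_def convergent_LIMSEQ_iff)
  \<comment> \<open>Fatou's lemma with \<open>n\<close> fixed and \<open>j\<close> tending to
    infinity. One instance yields \<open>square_integrable G\<close>, and all instances together
    yield convergence.\<close>
  have bound: "square_integrable (\<lambda>z. G z - rep_L2 (X n) z) \<and>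
      (norm (abs_L2 (\<lambda>z. G z - rep_L2 (X n) z)))\<^sup>2 \<le> e\<^sup>2"
    if e: "e > 0" and M: "\<And>m n. m \<ge> M \<Longrightarrow> n \<ge> M \<Longrightarrow> dist (X m) (X n) < e" and n: "n \<ge> M" for e M n
  proof -
    let ?I = "\<lambda>f. \<integral>\<^sup>+z. ennreal ((norm (f z - rep_L2 (X n) z))\<^sup>2) \<partial>circle_measure"
    have "?I G = (\<integral>\<^sup>+z. liminf (\<lambda>j. ennreal ((norm (g j z - rep_L2 (X n) z))\<^sup>2)) \<partial>circle_measure)"
    proof (rule nn_integral_cong_AE, use lim in eventually_elim)
      case (elim z)
      then have "(\<lambda>j. ennreal ((norm (g j z - rep_L2 (X n) z))\<^sup>2)) \<longlonglongrightarrow> ennreal ((norm (G z - rep_L2 (X n) z))\<^sup>2)"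
        by (intro tendsto_intros)
      then show ?case
        by (intro lim_imp_Liminf[symmetric]) auto
    qed
    also have "\<dots> \<le> liminf (\<lambda>j. ?I (g j))"
      by (rule nn_integral_liminf) measurable
    also have "\<dots> \<le> ennreal (e\<^sup>2)"
    proof (rule Liminf_le)
      show "\<forall>\<^sub>F j in sequentially. ?I (g j) \<le> ennreal (e\<^sup>2)"
        using eventually_ge_at_top[of M]
      proof eventually_elim
        case (elim j)
        have "?I (g j) = (\<integral>\<^sup>+z. ennreal ((norm (rep_L2 (X (r j) - X n) z))\<^sup>2) \<partial>circle_measure)"
          by (rule nn_integral_cong_AE)
             (use rep_minus_L2[of "X (r j)" "X n"] in eventually_elim, simp add: g_def)
        also have "\<dots> = ennreal ((norm (X (r j) - X n))\<^sup>2)"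
          by (rule nn_integral_rep_L2)
        also have "\<dots> \<le> ennreal (e\<^sup>2)"
          using M[OF order_trans[OF elim r(1)] n]
          by (intro ennreal_leI power_mono) (auto simp: dist_norm)
        finally show ?case .
      qed
    qed simp
    finally show ?thesis
      using square_integrableI_nn_integral[of "\<lambda>z. G z - rep_L2 (X n) z" "e\<^sup>2"] by simp
  qed
  have cau: "\<exists>M. \<forall>m\<ge>M. \<forall>n\<ge>M. dist (X m) (X n) < e" if "e > 0" for e
    using assms that unfolding Cauchy_def by simp
  have sq: "square_integrable G"
  proof -
    obtain M where "\<And>m n. m \<ge> M \<Longrightarrow> n \<ge> M \<Longrightarrow> dist (X m) (X n) < 1"
      using cau[of 1] by auto
    then have "square_integrable (\<lambda>z. G z - rep_L2 (X M) z)"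
      using bound[of 1 M M] by simp
    from square_integrable_add[OF this square_integrable_rep_L2[of "X M"]] show ?thesis
      by simp
  qed
  have abs_diff: "abs_L2 (\<lambda>z. G z - rep_L2 (X n) z) = abs_L2 G - X n"
    if "square_integrable (\<lambda>z. G z - rep_L2 (X n) z)" for n
    unfolding L2_eq_iff
    using rep_abs_L2[OF that] rep_minus_L2[of "abs_L2 G" "X n"] rep_abs_L2[OF sq]
    by eventually_elim simp
  have "X \<longlonglongrightarrow> abs_L2 G"
  proof (rule LIMSEQ_I)
    fix e :: real assume "e > 0"
    then obtain M where M: "\<And>m n. m \<ge> M \<Longrightarrow> n \<ge> M \<Longrightarrow> dist (X m) (X n) < e / 2"
      using cau[of "e / 2"] by auto
    have "norm (X n - abs_L2 G) < e" if "n \<ge> M" for n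
    proof -
      have "(norm (abs_L2 G - X n))\<^sup>2 \<le> (e / 2)\<^sup>2"
        using bound[of "e / 2" M n] \<open>e > 0\<close> M that abs_diff[of n] by auto
      then have "norm (abs_L2 G - X n) \<le> e / 2"
        using \<open>e > 0\<close> by (simp add: power2_le_iff_abs_le)
      then show ?thesis using \<open>e > 0\<close> by (simp add: norm_minus_commute)
    qed
    then show "\<exists>M. \<forall>n\<ge>M. norm (X n - abs_L2 G) < e" by blast
  qed
  then show ?thesis by (rule convergentI)
qed

instance L2 :: complete_space
  by standard (rule Riesz_Fischer)

instance L2 :: banach ..

section \<open>Multiplication operators\<close>

text \<open>The bound is required at every point of the circle, not just almost everywhere. Boundary
  values of inner functions are therefore replaced by a version that is unimodular
  everywhere.\<close>

definition multiplier :: "(complex \<Rightarrow> complex) \<Rightarrow> bool" where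
  "multiplier \<phi> \<longleftrightarrow> \<phi> \<in> borel_measurable circle_measure \<and> (\<exists>B. \<forall>z\<in>sphere 0 1. norm (\<phi> z) \<le> B)"

definition mult_op :: "(complex \<Rightarrow> complex) \<Rightarrow> L2 \<Rightarrow> L2" where
  "mult_op \<phi> f = abs_L2 (\<lambda>z. \<phi> z * rep_L2 f z)"

lemma multiplier_measurable [measurable_dest]: "multiplier \<phi> \<Longrightarrow> \<phi> \<in> borel_measurable circle_measure"
  by (simp add: multiplier_def)

lemma multiplier_continuous:
  assumes "continuous_on (sphere 0 1) \<phi>"
  shows "multiplier \<phi>"
proof -
  have "bounded (\<phi> ` sphere 0 1)"
    by (intro compact_imp_bounded compact_continuous_image assms) auto
  then show ?thesis
    using measurable_circle_continuous[OF assms] by (auto simp: multiplier_def bounded_iff)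
qed

lemma multiplier_powi [simp]: "multiplier (\<lambda>z. z powi n)"
  by (intro multiplier_continuous continuous_intros) auto

lemma multiplier_ident [simp]: "multiplier (\<lambda>z. z)"
  by (intro multiplier_continuous continuous_intros)

lemma multiplier_const [simp]: "multiplier (\<lambda>_. c)"
  by (intro multiplier_continuous continuous_intros)

lemma multiplier_cnj [simp]: "multiplier \<phi> \<Longrightarrow> multiplier (\<lambda>z. cnj (\<phi> z))"
  by (simp add: multiplier_def borel_measurable_cnj_comp)

lemma multiplier_add [simp]:
  assumes "multiplier \<phi>" "multiplier \<psi>"
  shows "multiplier (\<lambda>z. \<phi> z + \<psi> z)"
proof -
  obtain B C where BC: "\<forall>z\<in>sphere 0 1. norm (\<phi> z) \<le> B" "\<forall>z\<in>sphere 0 1. norm (\<psi> z) \<le> C"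
    using assms by (auto simp: multiplier_def)
  have "norm (\<phi> z + \<psi> z) \<le> B + C" if "z \<in> sphere 0 1" for z
    using that BC by (intro norm_triangle_mono) auto
  then show ?thesis
    using assms unfolding multiplier_def by (blast intro: borel_measurable_add borel_measurable_times)
qed

lemma multiplier_mult [simp]:
  assumes "multiplier \<phi>" "multiplier \<psi>"
  shows "multiplier (\<lambda>z. \<phi> z * \<psi> z)"
proof -
  obtain B C where BC: "\<forall>z\<in>sphere 0 1. norm (\<phi> z) \<le> B" "\<forall>z\<in>sphere 0 1. norm (\<psi> z) \<le> C"
    using assms by (auto simp: multiplier_def)
  have "norm (\<phi> z * \<psi> z) \<le> B * C" if "z \<in> sphere 0 1" for z
    unfolding norm_mult using that BC by (intro mult_mono) (auto intro: order_trans[OF norm_ge_zero])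
  then show ?thesis
    using assms unfolding multiplier_def by (blast intro: borel_measurable_add borel_measurable_times)
qed

lemma square_integrable_mult:
  assumes "multiplier \<phi>" "square_integrable f"
  shows "square_integrable (\<lambda>z. \<phi> z * f z)"
proof -
  obtain B where B: "\<forall>z\<in>sphere 0 1. norm (\<phi> z) \<le> B"
    using assms by (auto simp: multiplier_def)
  have [measurable]: "\<phi> \<in> borel_measurable circle_measure" "f \<in> borel_measurable circle_measure"
    using assms by (auto simp: multiplier_def square_integrable_def)
  have "integrable circle_measure (\<lambda>z. B\<^sup>2 * (norm (f z))\<^sup>2)"
    using assms by (auto simp: square_integrable_def)
  then have "integrable circle_measure (\<lambda>z. (norm (\<phi> z * f z))\<^sup>2)"
    by (rule Bochner_Integration.integrable_bound)
       (use B in \<open>auto intro!: AE_I2 mult_right_mono power_mono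
         simp: space_circle_measure norm_mult power_mult_distrib abs_mult\<close>)
  then show ?thesis by (simp add: square_integrable_def)
qed

lemma rep_mult_op:
  assumes "multiplier \<phi>"
  shows "AE z in circle_measure. rep_L2 (mult_op \<phi> f) z = \<phi> z * rep_L2 f z"
  unfolding mult_op_def
  by (intro rep_abs_L2 square_integrable_mult assms square_integrable_rep_L2)

lemma mult_op_cong_AE:
  assumes "multiplier \<phi>" "multiplier \<psi>" "AE z in circle_measure. \<phi> z = \<psi> z"
  shows "mult_op \<phi> f = mult_op \<psi> f"
  unfolding L2_eq_iff using rep_mult_op[OF assms(1), of f] rep_mult_op[OF assms(2), of f] assms(3)
  by eventually_elim simp

lemma mult_op_cong:
  assumes "multiplier \<phi>" "\<And>z. norm z = 1 \<Longrightarrow> \<phi> z = \<psi> z"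
  shows "mult_op \<phi> f = mult_op \<psi> f"
proof (rule mult_op_cong_AE)
  show "multiplier \<psi>"
    using assms measurable_cong[of circle_measure \<phi> \<psi> borel]
    by (auto simp: multiplier_def space_circle_measure)
  show "AE z in circle_measure. \<phi> z = \<psi> z"
    using assms(2) by (intro AE_I2) (simp add: space_circle_measure)
qed (rule assms)

lemma mult_op_add:
  assumes "multiplier \<phi>"
  shows "mult_op \<phi> (f + g) = mult_op \<phi> f + mult_op \<phi> g"
  unfolding L2_eq_iff
  using rep_mult_op[OF assms, of "f + g"] rep_plus_L2[of f g] rep_plus_L2[of "mult_op \<phi> f" "mult_op \<phi> g"]
    rep_mult_op[OF assms, of f] rep_mult_op[OF assms, of g]
  by eventually_elim (simp add: algebra_simps)

lemma mult_op_scaleC: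
  assumes "multiplier \<phi>"
  shows "mult_op \<phi> (scaleC_L2 c f) = scaleC_L2 c (mult_op \<phi> f)"
  unfolding L2_eq_iff
  using rep_mult_op[OF assms, of "scaleC_L2 c f"] rep_scaleC_L2[of c f]
    rep_scaleC_L2[of c "mult_op \<phi> f"] rep_mult_op[OF assms, of f]
  by eventually_elim (simp add: algebra_simps)

lemma mult_op_diff:
  assumes "multiplier \<phi>"
  shows "mult_op \<phi> (f - g) = mult_op \<phi> f - mult_op \<phi> g"
  by (metis assms add_diff_cancel_right' diff_add_cancel mult_op_add)

lemma mult_op_const: "mult_op (\<lambda>_. c) f = scaleC_L2 c f"
  unfolding L2_eq_iff
  using rep_mult_op[of "\<lambda>_. c" f, simplified] rep_scaleC_L2[of c f]
  by eventually_elim simp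

lemma mult_op_plus:
  assumes "multiplier \<phi>" "multiplier \<psi>"
  shows "mult_op (\<lambda>z. \<phi> z + \<psi> z) f = mult_op \<phi> f + mult_op \<psi> f"
  unfolding L2_eq_iff
  using rep_mult_op[OF multiplier_add[OF assms], of f] rep_mult_op[OF assms(1), of f]
    rep_mult_op[OF assms(2), of f] rep_plus_L2[of "mult_op \<phi> f" "mult_op \<psi> f"]
  by eventually_elim (simp add: algebra_simps)

lemma cinner_mult_op:
  assumes "multiplier \<phi>"
  shows "cinner_L2 (mult_op \<phi> f) g = (\<integral>z. \<phi> z * rep_L2 f z * cnj (rep_L2 g z) \<partial>circle_measure)"
  unfolding cinner_L2_rep
proof (rule integral_cong_AE)
  show "AE z in circle_measure. rep_L2 (mult_op \<phi> f) z * cnj (rep_L2 g z) = \<phi> z * rep_L2 f z * cnj (rep_L2 g z)"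
    using rep_mult_op[OF assms, of f] by eventually_elim simp
qed (use multiplier_measurable[OF assms] in measurable)

lemma cinner_mult_op_right:
  assumes "multiplier \<phi>"
  shows "cinner_L2 f (mult_op \<phi> g) = cinner_L2 (mult_op (\<lambda>z. cnj (\<phi> z)) f) g"
  unfolding cinner_mult_op[OF multiplier_cnj[OF assms]]
  unfolding cinner_L2_rep
proof (rule integral_cong_AE)
  show "AE z in circle_measure. rep_L2 f z * cnj (rep_L2 (mult_op \<phi> g) z) =
      cnj (\<phi> z) * rep_L2 f z * cnj (rep_L2 g z)"
    using rep_mult_op[OF assms, of g] by eventually_elim simp
qed (use multiplier_measurable[OF multiplier_cnj[OF assms]] in measurable)

lemma mult_op_mult_op:
  assumes "multiplier \<phi>" "multiplier \<psi>"
  shows "mult_op \<phi> (mult_op \<psi> f) = mult_op (\<lambda>z. \<phi> z * \<psi> z) f"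
  unfolding L2_eq_iff
  using rep_mult_op[OF assms(1), of "mult_op \<psi> f"] rep_mult_op[OF assms(2), of f]
    rep_mult_op[OF multiplier_mult[OF assms], of f]
  by eventually_elim simp

section \<open>The trigonometric system\<close>

definition trig :: "int \<Rightarrow> L2" where
  "trig n = abs_L2 (\<lambda>z. z powi n)"

lemma square_integrable_powi: "square_integrable (\<lambda>z. z powi n)"
  using square_integrable_mult[OF multiplier_powi[of n], of "\<lambda>_. 1"]
  by (simp add: square_integrable_def)

lemma rep_trig: "AE z in circle_measure. rep_L2 (trig n) z = z powi n"
  unfolding trig_def by (rule rep_abs_L2[OF square_integrable_powi])

lemma fourier_coeff_eq_cinner: "fourier_coeff f n = cinner_L2 f (trig n)"
  unfolding fourier_coeff_rep cinner_L2_rep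
proof (rule integral_cong_AE)
  show "AE z in circle_measure. rep_L2 f z * cnj (z powi n) = rep_L2 f z * cnj (rep_L2 (trig n) z)"
    using rep_trig[of n] by eventually_elim simp
qed (use multiplier_measurable[OF multiplier_cnj[OF multiplier_powi[of n]]] in measurable)

lemma mult_z_eq_mult_op: "mult_z f = mult_op (\<lambda>z. z) f"
  unfolding mult_op_def mult_z_def by simp

lemma mult_op_trig: "mult_op (\<lambda>z. z powi m) (trig n) = trig (m + n)"
  unfolding L2_eq_iff
  using rep_mult_op[OF multiplier_powi, of m "trig n"] rep_trig[of n] rep_trig[of "m + n"] AE_space
  by eventually_elim (auto simp: space_circle_measure intro!: power_int_add[symmetric])

lemma cnj_eq_inverse: "norm z = 1 \<Longrightarrow> cnj z = inverse z"
  by (metis complex_norm_square inverse_unique of_real_1 power_one)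

lemma cnj_powi: "norm z = 1 \<Longrightarrow> cnj (z powi n) = z powi (-n)"
  by (simp add: cnj_eq_inverse power_int_minus power_int_inverse)

lemma cinner_mult_op_trig:
  assumes "multiplier \<phi>"
  shows "cinner_L2 (mult_op \<phi> (trig m)) (trig n) = (\<integral>z. \<phi> z * z powi (m - n) \<partial>circle_measure)"
  unfolding cinner_mult_op[OF assms]
proof (rule integral_cong_AE)
  show "AE z in circle_measure. \<phi> z * rep_L2 (trig m) z * cnj (rep_L2 (trig n) z) = \<phi> z * z powi (m - n)"
    using rep_trig[of m] rep_trig[of n] AE_space
  proof eventually_elim
    case (elim z)
    then have "norm z = 1" by (simp add: space_circle_measure)
    then have "z powi m * cnj (z powi n) = z powi (m - n)"
      unfolding cnj_powi[OF \<open>norm z = 1\<close>]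
      using \<open>norm z = 1\<close> power_int_add[of z m "- n"] by fastforce
    with elim show ?case by (simp add: mult.assoc)
  qed
qed (use multiplier_measurable[OF assms] multiplier_measurable[OF multiplier_powi] in measurable)

text \<open>The mean value property covers \<open>n \<ge> 0\<close>; on the circle, conjugation
  exchanges \<open>n\<close> and \<open>- n\<close>.\<close>

lemma integral_powi: "(\<integral>z. z powi n \<partial>circle_measure) = (if n = 0 then 1 else 0)"
proof -
  have pos: "(\<integral>z. z powi n \<partial>circle_measure) = (if n = 0 then 1 else 0)" if "n \<ge> 0" for n
    using integral_circle_holomorphic[of "\<lambda>z. z ^ nat n"] that
    by (auto simp: power_int_def zero_power holomorphic_on_power[OF holomorphic_on_ident])
  show ?thesis
  proof (cases "n \<ge> 0")
    case False
    have "(\<integral>z. z powi n \<partial>circle_measure) = (\<integral>z. cnj (z powi (- n)) \<partial>circle_measure)"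
      by (rule Bochner_Integration.integral_cong) (auto simp: space_circle_measure cnj_powi simp del: complex_cnj_power_int)
    also have "\<dots> = cnj (\<integral>z. z powi (- n) \<partial>circle_measure)"
      by (rule Bochner_Integration.integral_cnj)
    finally show ?thesis using pos[of "- n"] False by simp
  qed (rule pos)
qed

lemma cinner_trig: "cinner_L2 (trig m) (trig n) = (if m = n then 1 else 0)"
  using cinner_mult_op_trig[OF multiplier_const, of 1 m n] by (simp add: mult_op_const integral_powi)

lemma fourier_coeff_trig: "fourier_coeff (trig m) n = (if m = n then 1 else 0)"
  by (simp add: fourier_coeff_eq_cinner cinner_trig)

lemma fourier_coeff_add: "fourier_coeff (f + g) n = fourier_coeff f n + fourier_coeff g n"
  by (simp add: fourier_coeff_eq_cinner cinner_add_left)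

lemma fourier_coeff_diff: "fourier_coeff (f - g) n = fourier_coeff f n - fourier_coeff g n"
  by (simp add: fourier_coeff_eq_cinner cinner_diff_left)

lemma fourier_coeff_scaleC: "fourier_coeff (scaleC_L2 c f) n = c * fourier_coeff f n"
  by (simp add: fourier_coeff_eq_cinner cinner_scaleC_left)

lemma fourier_coeff_powi: "fourier_coeff (mult_op (\<lambda>z. z powi m) f) n = fourier_coeff f (n - m)"
proof -
  have "fourier_coeff (mult_op (\<lambda>z. z powi m) f) n = cinner_L2 f (mult_op (\<lambda>z. cnj (z powi m)) (trig n))"
    unfolding fourier_coeff_eq_cinner
    by (subst cinner_mult_op_right) (simp_all del: complex_cnj_power_int add: multiplier_cnj)
  also have "mult_op (\<lambda>z. cnj (z powi m)) (trig n) = mult_op (\<lambda>z. z powi (- m)) (trig n)"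
    by (rule mult_op_cong) (simp_all del: complex_cnj_power_int add: cnj_powi)
  finally show ?thesis by (simp add: mult_op_trig fourier_coeff_eq_cinner)
qed

lemma fourier_coeff_mult_z: "fourier_coeff (mult_z f) n = fourier_coeff f (n - 1)"
  using fourier_coeff_powi[of 1 f n] by (simp add: mult_z_eq_mult_op)

section \<open>Completeness of the trigonometric system\<close>

lemma integrable_rep_L2: "integrable circle_measure (rep_L2 f)"
  using integrable_mult_cnj[OF square_integrable_rep_L2[of f], of "\<lambda>_. 1"]
  by (simp add: square_integrable_def)

lemma fourier_coeff_zero_mult_op:
  assumes "multiplier \<phi>"
  shows "fourier_coeff (mult_op \<phi> f) 0 = (\<integral>z. \<phi> z * rep_L2 f z \<partial>circle_measure)"
  unfolding fourier_coeff_rep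
proof (rule integral_cong_AE)
  show "AE z in circle_measure. rep_L2 (mult_op \<phi> f) z * cnj (z powi 0) = \<phi> z * rep_L2 f z"
    using rep_mult_op[OF assms, of f] by eventually_elim simp
qed (use multiplier_measurable[OF assms] in auto)

lemma multiplier_real_polynomial:
  "real_polynomial_function p \<Longrightarrow> multiplier (\<lambda>z. of_real (p z))"
  by (intro multiplier_continuous continuous_on_of_real continuous_at_imp_continuous_on
      ballI continuous_real_polymonial_function)

text \<open>On the circle, \<open>Re z\<close> and \<open>Im z\<close> are combinations of \<open>z\<close> and \<open>z powi (-1)\<close>.\<close>

lemma fourier_coeffs_zero_real_polynomial:
  assumes "real_polynomial_function p" and "\<And>n. fourier_coeff f n = 0"
  shows "fourier_coeff (mult_op (\<lambda>z. of_real (p z)) f) n = 0"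
  using assms
\<comment> \<open>The function is generalized for the product case: by the hypothesis for
  \<open>q\<close>, all coefficients of \<open>q f\<close> vanish, so the hypothesis for
  \<open>p\<close> applies to \<open>q f\<close> in place of \<open>f\<close>.\<close>
proof (induction arbitrary: f n)
  case (linear p)
  note p = linear.hyps and f0 = linear.prems
  interpret bounded_linear p by (rule p)
  \<comment> \<open>These come from \<open>p z = Re z * p 1 + Im z * p \<i>\<close> by substituting
    \<open>(z + cnj z) / 2\<close> for \<open>Re z\<close> and
    \<open>(z - cnj z) / (2 * \<i>)\<close> for \<open>Im z\<close>.\<close>
  define \<alpha> where "\<alpha> = (of_real (p 1) - \<i> * of_real (p \<i>)) / 2"
  define \<beta> where "\<beta> = (of_real (p 1) + \<i> * of_real (p \<i>)) / 2"
  have "of_real (p z) = \<alpha> * z powi 1 + \<beta> * z powi (-1)" if "norm z = 1" for z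
  proof -
    have "z = Re z *\<^sub>R 1 + Im z *\<^sub>R \<i>"
      by (simp add: complex_eq_iff)
    then have "p z = Re z * p 1 + Im z * p \<i>"
      by (metis add real_scaleR_def scaleR)
    moreover have "z powi (-1) = cnj z"
      using that by (simp add: cnj_eq_inverse power_int_minus)
    ultimately show ?thesis
      by (simp add: \<alpha>_def \<beta>_def complex_eq_iff algebra_simps add_divide_distrib diff_divide_distrib)
  qed
  then have "mult_op (\<lambda>z. of_real (p z)) f = mult_op (\<lambda>z. \<alpha> * z powi 1 + \<beta> * z powi (-1)) f"
    by (intro mult_op_cong multiplier_real_polynomial real_polynomial_function.intros(1) p)
  also have "\<dots> = scaleC_L2 \<alpha> (mult_op (\<lambda>z. z powi 1) f) + scaleC_L2 \<beta> (mult_op (\<lambda>z. z powi (-1)) f)"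
    by (subst mult_op_plus)
       (simp_all only: mult_op_mult_op[symmetric] mult_op_const multiplier_const multiplier_powi multiplier_mult)
  finally show ?case
    by (simp only: fourier_coeff_add fourier_coeff_scaleC fourier_coeff_powi f0) simp
next
  case (const c)
  then show ?case by (simp add: mult_op_const fourier_coeff_scaleC)
next
  case (add p q)
  then have "mult_op (\<lambda>z. of_real (p z + q z)) f =
      mult_op (\<lambda>z. of_real (p z)) f + mult_op (\<lambda>z. of_real (q z)) f"
    by (simp add: mult_op_plus multiplier_real_polynomial)
  with add show ?case by (simp add: fourier_coeff_add)
next
  case (mult p q)
  then have "mult_op (\<lambda>z. of_real (p z * q z)) f =
      mult_op (\<lambda>z. of_real (p z)) (mult_op (\<lambda>z. of_real (q z)) f)"
    by (simp add: mult_op_mult_op multiplier_real_polynomial)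
  with mult show ?case by simp
qed

text \<open>By Stone-Weierstrass, \<open>\<phi>\<close> is uniformly close on the circle to a
  polynomial, whose integral against \<open>f\<close> is zero; the error is at most the tolerance
  times the integral \<open>?K\<close> of \<open>norm f\<close>.\<close>

lemma integral_continuous_zero:
  fixes \<phi> :: "complex \<Rightarrow> real"
  assumes "\<And>n. fourier_coeff f n = 0" and cont: "continuous_on UNIV \<phi>"
  shows "(\<integral>z. of_real (\<phi> z) * rep_L2 f z \<partial>circle_measure) = 0"
proof -
  let ?K = "\<integral>z. norm (rep_L2 f z) \<partial>circle_measure"
  have mphi: "multiplier (\<lambda>z. of_real (\<phi> z))"
    by (intro multiplier_continuous continuous_on_of_real continuous_on_subset[OF cont]) auto
  have int: "integrable circle_measure (\<lambda>z. \<psi> z * rep_L2 f z)" if "multiplier \<psi>" for \<psi>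
  proof -
    have "square_integrable (\<lambda>z. \<psi> z * rep_L2 f z)"
      by (rule square_integrable_mult[OF that square_integrable_rep_L2])
    from integrable_mult_cnj[OF this, of "\<lambda>_. 1"] show ?thesis
      by (simp add: square_integrable_def)
  qed
  have le: "norm (\<integral>z. of_real (\<phi> z) * rep_L2 f z \<partial>circle_measure) \<le> e * ?K" if e: "e > 0" for e
  proof -
    obtain p where p: "real_polynomial_function p" "\<And>z. z \<in> sphere 0 1 \<Longrightarrow> \<bar>\<phi> z - p z\<bar> < e"
      by (rule Stone_Weierstrass_real_polynomial_function[of "sphere 0 1" \<phi> e])
         (use e continuous_on_subset[OF cont] in auto)
    note mp = multiplier_real_polynomial[OF p(1)]
    have "(\<integral>z. of_real (p z) * rep_L2 f z \<partial>circle_measure) = 0"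
      using fourier_coeffs_zero_real_polynomial[OF p(1) assms(1), of 0]
      by (simp add: fourier_coeff_zero_mult_op[OF mp])
    then have "(\<integral>z. of_real (\<phi> z) * rep_L2 f z \<partial>circle_measure) =
        (\<integral>z. of_real (\<phi> z) * rep_L2 f z - of_real (p z) * rep_L2 f z \<partial>circle_measure)"
      by (simp add: int mphi mp)
    also have "norm \<dots> \<le> (\<integral>z. e * norm (rep_L2 f z) \<partial>circle_measure)"
    proof (rule Bochner_Integration.integral_norm_bound_integral)
      fix z assume "z \<in> space circle_measure"
      then have "\<bar>\<phi> z - p z\<bar> \<le> e"
        using p(2)[of z] by (simp add: space_circle_measure)
      then show "norm (of_real (\<phi> z) * rep_L2 f z - of_real (p z) * rep_L2 f z) \<le> e * norm (rep_L2 f z)"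
        unfolding left_diff_distrib[symmetric] of_real_diff[symmetric] norm_mult norm_of_real
        by (rule mult_right_mono) simp
    qed (use int mphi mp integrable_rep_L2 in auto)
    finally show ?thesis by simp
  qed
  have "norm (\<integral>z. of_real (\<phi> z) * rep_L2 f z \<partial>circle_measure) \<le> 0"
  proof (rule field_le_epsilon)
    fix e :: real assume "e > 0"
    \<comment> \<open>The tolerance used is \<open>e / (?K + 1)\<close>; adding 1 keeps the
      denominator positive when \<open>?K = 0\<close>.\<close>
    have "?K \<ge> 0" by simp
    then have "?K / (?K + 1) \<le> 1"
      using divide_le_eq_1_pos[of "?K + 1" ?K] by linarith
    then have "e * (?K / (?K + 1)) \<le> e * 1"
      using \<open>e > 0\<close> by (intro mult_left_mono) auto
    then have "e / (?K + 1) * ?K \<le> e" by simp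
    with le[of "e / (?K + 1)"] \<open>e > 0\<close> \<open>?K \<ge> 0\<close>
    show "norm (\<integral>z. of_real (\<phi> z) * rep_L2 f z \<partial>circle_measure) \<le> 0 + e"
      by (smt (verit) divide_pos_pos)
  qed
  then show ?thesis by simp
qed

text \<open>The indicator of a closed set is the pointwise limit of the continuous functions
  \<open>max 0 (1 - n * infdist z C)\<close>, which lie between 0 and 1, so dominated convergence
  applies.\<close>

lemma integral_closed_zero:
  assumes "\<And>n. fourier_coeff f n = 0" and "closed C"
  shows "(LINT z:(C \<inter> sphere 0 1)|circle_measure. rep_L2 f z) = 0"
\<comment> \<open>The empty set is separate because \<open>infdist\<close> to it is 0 by convention,
  and the approximating functions would be constantly 1.\<close>
proof (cases "C = {}")
  case False
  define \<phi> where "\<phi> n z = max 0 (1 - real n * infdist z C)" for n z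
  have cont: "continuous_on UNIV (\<phi> n)" for n
    unfolding \<phi>_def by (intro continuous_intros)
  have lim: "(\<lambda>n. \<phi> n z) \<longlonglongrightarrow> indicator C z" for z
  proof (cases "z \<in> C")
    case True
    then show ?thesis by (simp add: \<phi>_def)
  next
    case z: False
    then have pos: "infdist z C > 0"
      by (rule infdist_pos_not_in_closed[OF \<open>closed C\<close> False])
    obtain N :: nat where N: "1 / infdist z C \<le> real N"
      using real_arch_simple by blast
    have "\<phi> n z = 0" if "n \<ge> N" for n
    proof -
      have "1 / infdist z C \<le> real n" using N that by linarith
      then show ?thesis using pos by (simp add: \<phi>_def field_simps)
    qed
    then have "\<forall>\<^sub>F n in sequentially. \<phi> n z = 0"
      by (auto simp: eventually_sequentially)
    then show ?thesis using z by (simp add: tendsto_eventually)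
  qed
  have "(\<lambda>n. \<integral>z. of_real (\<phi> n z) * rep_L2 f z \<partial>circle_measure) \<longlonglongrightarrow>
      (\<integral>z. indicator (C \<inter> sphere 0 1) z *\<^sub>R rep_L2 f z \<partial>circle_measure)"
  proof (rule integral_dominated_convergence[where w = "\<lambda>z. norm (rep_L2 f z)"])
    have "C \<inter> sphere 0 1 \<in> sets circle_measure"
      using \<open>closed C\<close> by (auto simp: sets_circle_measure sets_restrict_space Int_commute)
    then show "(\<lambda>z. indicator (C \<inter> sphere 0 1) z *\<^sub>R rep_L2 f z) \<in> borel_measurable circle_measure"
      by measurable
    have [measurable]: "(\<lambda>z. complex_of_real (\<phi> n z)) \<in> borel_measurable circle_measure" for n
      by (intro measurable_circle_continuous continuous_on_of_real continuous_on_subset[OF cont]) auto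
    show "(\<lambda>z. of_real (\<phi> n z) * rep_L2 f z) \<in> borel_measurable circle_measure" for n
      by measurable
    show "AE z in circle_measure. (\<lambda>n. of_real (\<phi> n z) * rep_L2 f z) \<longlonglongrightarrow>
        indicator (C \<inter> sphere 0 1) z *\<^sub>R rep_L2 f z"
    proof (rule AE_I2)
      fix z assume "z \<in> space circle_measure"
      then have "indicator (C \<inter> sphere 0 1) z *\<^sub>R rep_L2 f z = of_real (indicator C z) * rep_L2 f z"
        by (simp add: space_circle_measure indicator_def)
      then show "(\<lambda>n. of_real (\<phi> n z) * rep_L2 f z) \<longlonglongrightarrow> indicator (C \<inter> sphere 0 1) z *\<^sub>R rep_L2 f z"
        by (simp only:) (intro tendsto_intros lim)
    qed
    show "AE z in circle_measure. norm (of_real (\<phi> n z) * rep_L2 f z) \<le> norm (rep_L2 f z)" for n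
      by (intro AE_I2) (auto simp: norm_mult \<phi>_def infdist_nonneg intro!: mult_left_le_one_le)
  qed (simp add: integrable_rep_L2)
  then show ?thesis
    unfolding set_lebesgue_integral_def
    by (simp add: integral_continuous_zero[OF assms(1) cont] LIMSEQ_const_iff)
qed (simp add: set_lebesgue_integral_def)

lemma sets_circle_Int: "A \<in> sets borel \<Longrightarrow> A \<inter> sphere 0 1 \<in> sets circle_measure"
  by (auto simp: sets_circle_measure sets_restrict_space Int_commute)

text \<open>A Dynkin class argument: closed sets are stable under intersection and generate the
  Borel sets, and the property of having integral zero passes to complements and countable disjoint
  unions. A function whose integral over every measurable set is zero vanishes almost
  everywhere.\<close>

theorem fourier_coeffs_zero_imp_zero:
  assumes zero: "\<And>n. fourier_coeff f n = 0"
  shows "f = 0"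
proof -
  let ?I = "\<lambda>A. LINT z:(A \<inter> sphere 0 1)|circle_measure. rep_L2 f z"
  have si: "set_integrable circle_measure (A \<inter> sphere 0 1) (rep_L2 f)" if "A \<in> sets borel" for A
    unfolding set_integrable_def
    by (rule integrable_mult_indicator[OF sets_circle_Int[OF that] integrable_rep_L2])
  have "Int_stable (Collect closed :: complex set set)" "Collect closed \<subseteq> Pow (UNIV :: complex set)"
    by (auto simp: Int_stable_def)
  then have I: "?I A = 0" if "A \<in> sigma_sets UNIV (Collect closed)" for A
    using that
  proof (induction rule: sigma_sets_induct_disjoint)
    case (basic A)
    then show ?case using integral_closed_zero[OF zero] by simp
  next
    case (compl A)
    then have A: "A \<in> sets borel" by (simp add: borel_eq_closed)
    have "?I (A \<union> (UNIV - A)) = (LINT z:((A \<inter> sphere 0 1) \<union> ((UNIV - A) \<inter> sphere 0 1))|circle_measure. rep_L2 f z)"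
      by (simp only: Int_Un_distrib2)
    also have "\<dots> = ?I A + ?I (UNIV - A)"
      by (rule set_integral_Un) (use si A in auto)
    finally have "?I UNIV = ?I A + ?I (UNIV - A)" by simp
    then show ?case
      using compl integral_closed_zero[OF zero closed_UNIV] by simp
  next
    case (union A)
    then have A: "A i \<in> sets borel" for i by (auto simp: borel_eq_closed)
    have "?I (\<Union>i. A i) = (LINT z:(\<Union>i. A i \<inter> sphere 0 1)|circle_measure. rep_L2 f z)"
    proof -
      have "(\<Union>i. A i) \<inter> sphere 0 1 = (\<Union>i. A i \<inter> sphere 0 1)" by auto
      then show ?thesis by (simp only:)
    qed
    also have "\<dots> = (\<Sum>i. ?I (A i))"
    proof (rule lebesgue_integral_countable_add)
      show "(A i \<inter> sphere 0 1) \<inter> (A j \<inter> sphere 0 1) = {}" if "i \<noteq> j" for i j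
        using union(1) that by (auto simp: disjoint_family_on_def)
      have "(\<Union>i. A i) \<in> sets borel" using A by auto
      from si[OF this] show "set_integrable circle_measure (\<Union>i. A i \<inter> sphere 0 1) (rep_L2 f)"
        by simp
    qed (use A sets_circle_Int in auto)
    finally show ?case using union by simp
  qed (simp add: set_lebesgue_integral_def)
  have "AE z in circle_measure. rep_L2 f z = 0"
  proof (rule circle.density_zero[OF integrable_rep_L2])
    fix A assume "A \<in> sets circle_measure"
    then obtain B where "B \<in> sets borel" "A = B \<inter> sphere 0 1"
      by (auto simp: sets_circle_measure sets_restrict_space)
    then show "(LINT z:A|circle_measure. rep_L2 f z) = 0"
      using I[of B] by (simp add: borel_eq_closed)
  qed
  then show ?thesis
    unfolding L2_eq_iff using rep_zero_L2 by eventually_elim simp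
qed

section \<open>The Riesz projection\<close>

text \<open>\<open>conj_hardy2\<close> is the space of conjugates of functions in \<open>z H\<^sup>2\<close>.\<close>

definition conj_hardy2 :: "L2 set" where
  "conj_hardy2 = {f. \<forall>n\<ge>0. fourier_coeff f n = 0}"

definition riesz_term :: "L2 \<Rightarrow> nat \<Rightarrow> L2" where
  "riesz_term f n = scaleC_L2 (fourier_coeff f (int n)) (trig (int n))"

text \<open>Given by a series, so that inner products can be taken term by term; convergence is
  \<open>summable_riesz_term\<close>.\<close>

definition riesz_proj :: "L2 \<Rightarrow> L2" where
  "riesz_proj f = (\<Sum>n. riesz_term f n)"

lemma inner_riesz_term:
  "inner (riesz_term f m) (riesz_term f n) = (if m = n then (norm (fourier_coeff f (int n)))\<^sup>2 else 0)"
proof -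
  have "cinner_L2 (riesz_term f m) (riesz_term f n) =
      (if m = n then of_real ((norm (fourier_coeff f (int n)))\<^sup>2) else 0)"
    by (simp add: riesz_term_def cinner_scaleC_left cinner_scaleC_right cinner_trig
        complex_norm_square[symmetric] mult.commute)
  then show ?thesis by (simp add: inner_L2_def)
qed

lemma norm_sum_riesz_term:
  assumes "finite I"
  shows "(norm (sum (riesz_term f) I))\<^sup>2 = (\<Sum>n\<in>I. (norm (fourier_coeff f (int n)))\<^sup>2)"
proof -
  have "(norm (sum (riesz_term f) I))\<^sup>2 = (\<Sum>n\<in>I. (norm (riesz_term f n))\<^sup>2)"
    by (rule norm_sum_Pythagorean[OF assms])
       (auto simp: pairwise_def orthogonal_def inner_riesz_term)
  then show ?thesis by (simp add: power2_norm_eq_inner inner_riesz_term)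
qed

text \<open>Bessel's inequality: a partial sum \<open>S\<close> satisfies
  \<open>inner f S = (norm S)\<^sup>2\<close>, and Cauchy-Schwarz bounds the left side.\<close>

lemma norm_sum_riesz_term_le:
  assumes "finite I"
  shows "norm (sum (riesz_term f) I) \<le> norm f"
proof -
  have "inner f (riesz_term f n) = (norm (fourier_coeff f (int n)))\<^sup>2" for n
  proof -
    have "cinner_L2 f (riesz_term f n) = of_real ((norm (fourier_coeff f (int n)))\<^sup>2)"
      by (simp add: riesz_term_def cinner_scaleC_right fourier_coeff_eq_cinner[symmetric]
          complex_norm_square[symmetric] mult.commute)
    then show ?thesis by (simp add: inner_L2_def)
  qed
  then have "inner f (sum (riesz_term f) I) = (norm (sum (riesz_term f) I))\<^sup>2"
    by (simp add: inner_sum_right norm_sum_riesz_term[OF assms])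
  then have "norm (sum (riesz_term f) I) * norm (sum (riesz_term f) I) \<le> norm f * norm (sum (riesz_term f) I)"
    using norm_cauchy_schwarz[of f "sum (riesz_term f) I"] by (simp add: power2_eq_square)
  then show ?thesis
    by (cases "norm (sum (riesz_term f) I) = 0") (auto dest: mult_right_le_imp_le)
qed

text \<open>Bessel's inequality makes the squared coefficients summable; by orthogonality their
  tails are the squared norms of the tails of the series, and completeness gives
  convergence.\<close>

lemma summable_riesz_term: "summable (riesz_term f)"
  unfolding summable_Cauchy
proof (intro allI impI)
  fix e :: real assume "e > 0"
  have "summable (\<lambda>n. (norm (fourier_coeff f (int n)))\<^sup>2)"
  proof (rule bounded_imp_summable)
    show "(\<Sum>n\<le>N. (norm (fourier_coeff f (int n)))\<^sup>2) \<le> (norm f)\<^sup>2" for N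
      unfolding norm_sum_riesz_term[OF finite_atMost, symmetric]
      by (intro power_mono norm_sum_riesz_term_le) auto
  qed simp
  then obtain N where N: "\<And>m n. m \<ge> N \<Longrightarrow> norm (\<Sum>k\<in>{m..<n}. (norm (fourier_coeff f (int k)))\<^sup>2) < e\<^sup>2"
    unfolding summable_Cauchy using \<open>e > 0\<close> by (metis zero_less_power)
  have "norm (sum (riesz_term f) {m..<n}) < e" if "m \<ge> N" for m n
  proof -
    have "(norm (sum (riesz_term f) {m..<n}))\<^sup>2 < e\<^sup>2"
      using N[OF that, of n] by (simp add: norm_sum_riesz_term)
    then show ?thesis using \<open>e > 0\<close> by (meson less_imp_le power_less_imp_less_base)
  qed
  then show "\<exists>N. \<forall>m\<ge>N. \<forall>n. norm (sum (riesz_term f) {m..<n}) < e" by blast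
qed

lemma cinner_riesz_proj: "cinner_L2 (riesz_proj f) g = (\<Sum>n. cinner_L2 (riesz_term f n) g)"
  unfolding riesz_proj_def
  by (rule bounded_linear.suminf[OF bounded_linear_cinner_left summable_riesz_term])

lemma fourier_coeff_riesz_proj:
  "fourier_coeff (riesz_proj f) n = (if n \<ge> 0 then fourier_coeff f n else 0)"
proof (cases "n \<ge> 0")
  case True
  then obtain k where k: "n = int k" using zero_le_imp_eq_int by blast
  have "fourier_coeff (riesz_proj f) n = (\<Sum>m. if m = k then fourier_coeff f (int m) else 0)"
    unfolding fourier_coeff_eq_cinner[of "riesz_proj f"] cinner_riesz_proj
    by (intro suminf_cong) (simp add: riesz_term_def cinner_scaleC_left cinner_trig k)
  also have "\<dots> = fourier_coeff f (int k)"
    by (rule sums_unique[OF sums_single, symmetric])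
  finally show ?thesis using True k by simp
next
  case False
  then have "fourier_coeff (riesz_proj f) n = (\<Sum>m. 0)"
    unfolding fourier_coeff_eq_cinner[of "riesz_proj f"] cinner_riesz_proj
    by (intro suminf_cong) (simp add: riesz_term_def cinner_scaleC_left cinner_trig)
  then show ?thesis using False by simp
qed

lemma riesz_proj_hardy2: "riesz_proj f \<in> hardy2"
  by (simp add: hardy2_def fourier_coeff_riesz_proj)

lemma diff_riesz_proj_conj_hardy2: "f - riesz_proj f \<in> conj_hardy2"
  by (simp add: conj_hardy2_def fourier_coeff_diff fourier_coeff_riesz_proj)

lemma L2_eqI_fourier: "(\<And>n. fourier_coeff f n = fourier_coeff g n) \<Longrightarrow> f = g"
  using fourier_coeffs_zero_imp_zero[of "f - g"] by (simp add: fourier_coeff_diff)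

lemma riesz_proj_eqI:
  assumes "g \<in> hardy2" "h \<in> conj_hardy2"
  shows "riesz_proj (g + h) = g"
  using assms
  by (intro L2_eqI_fourier) (auto simp: fourier_coeff_riesz_proj fourier_coeff_add hardy2_def conj_hardy2_def)

text \<open>Because coefficients determine a vector, \<open>f\<close> equals its Riesz projection.
  Expanded as a series, each of its terms is a multiple of some \<open>trig (int n)\<close>, to
  which \<open>g\<close> is orthogonal.\<close>

lemma cinner_hardy2_conj_hardy2:
  assumes f: "f \<in> hardy2" and g: "g \<in> conj_hardy2"
  shows "cinner_L2 f g = 0" and "cinner_L2 g f = 0"
proof -
  have "f = riesz_proj f"
    using riesz_proj_eqI[OF f, of 0] g
    by (simp add: conj_hardy2_def fourier_coeff_eq_cinner)
  then have "cinner_L2 f g = (\<Sum>n. cinner_L2 (riesz_term f n) g)"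
    by (metis cinner_riesz_proj)
  also have "\<dots> = (\<Sum>n. 0)"
  proof (rule suminf_cong)
    fix n :: nat
    have "cinner_L2 (trig (int n)) g = 0"
      using g by (subst cinner_commute) (simp add: conj_hardy2_def fourier_coeff_eq_cinner)
    then show "cinner_L2 (riesz_term f n) g = 0"
      by (simp add: riesz_term_def cinner_scaleC_left)
  qed
  finally show "cinner_L2 f g = 0" by simp
  then show "cinner_L2 g f = 0" by (subst cinner_commute) simp
qed

section \<open>Boundary values of inner functions\<close>

text \<open>A sequence of radii in place of the filter \<open>at_left 1\<close>: it keeps the limit
  function measurable and fits dominated convergence. The shift by 2 keeps every radius strictly
  positive.\<close>

definition radius :: "nat \<Rightarrow> real" where
  "radius n = 1 - 1 / real (n + 2)"

lemma radius: "0 < radius n" "radius n < 1"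
  by (simp_all add: radius_def field_simps)

lemma filterlim_radius: "filterlim radius (at_left 1) sequentially"
proof -
  have "radius \<longlonglongrightarrow> 1 - 0"
    unfolding radius_def by (intro tendsto_intros LIMSEQ_ignore_initial_segment lim_1_over_n)
  then show ?thesis
    by (simp add: filterlim_at less_imp_neq[OF radius(2)] radius(2))
qed

text \<open>\<open>boundary_fun\<close> is arbitrary where the radial limit does not exist; \<open>inner_bdry\<close> is an almost
  everywhere equal function that is measurable and unimodular everywhere.\<close>

definition inner_bdry :: "(complex \<Rightarrow> complex) \<Rightarrow> complex \<Rightarrow> complex" where
  "inner_bdry u z =
     (let l = lim (\<lambda>n. u (of_real (radius n) * z)) in if norm l = 1 then l else 1)"

lemma norm_inner_bdry [simp]: "norm (inner_bdry u z) = 1"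
  by (simp add: inner_bdry_def Let_def)

lemma radius_times_sphere:
  assumes "z \<in> cball 0 1"
  shows "of_real (radius n) * z \<in> ball (0::complex) 1"
proof -
  have "radius n * norm z \<le> radius n"
    using assms radius[of n] by (intro mult_left_le) auto
  also have "\<dots> < 1" by (rule radius)
  finally show ?thesis using radius(1)[of n] by (simp add: norm_mult)
qed

context
  fixes u :: "complex \<Rightarrow> complex"
  assumes inner: "inner_function u"
begin

text \<open>Dilation moves the closed disk inside the open one, so the mean value property applies
  although \<open>u\<close> has no regularity on the circle.\<close>

lemma holomorphic_dilation: "(\<lambda>z. u (of_real (radius n) * z)) holomorphic_on cball 0 1"
proof -
  have "(u \<circ> (\<lambda>z. of_real (radius n) * z)) holomorphic_on cball 0 1"
  proof (rule holomorphic_on_compose_gen)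
    show "u holomorphic_on ball 0 1" using inner by (simp add: inner_function_def)
    show "(\<lambda>z. of_real (radius n) * z) holomorphic_on cball 0 1" by (intro holomorphic_intros)
  qed (use radius_times_sphere in blast)
  then show ?thesis by (simp add: o_def)
qed

lemma measurable_dilation: "(\<lambda>z. u (of_real (radius n) * z)) \<in> borel_measurable circle_measure"
  by (intro measurable_circle_continuous holomorphic_on_imp_continuous_on
      holomorphic_on_subset[OF holomorphic_dilation]) auto

lemma measurable_inner_bdry: "inner_bdry u \<in> borel_measurable circle_measure"
proof -
  note [measurable] = measurable_dilation
  show ?thesis unfolding inner_bdry_def Let_def by measurable
qed

lemma multiplier_inner_bdry: "multiplier (inner_bdry u)"
  using measurable_inner_bdry by (auto simp: multiplier_def intro: exI[of _ 1])

lemma AE_inner_bdry: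
  "AE z in circle_measure. (\<lambda>n. u (of_real (radius n) * z)) \<longlonglongrightarrow> inner_bdry u z \<and>
     boundary_fun u z = inner_bdry u z"
proof -
  have "AE z in circle_measure.
      \<exists>l. ((\<lambda>r. u (of_real r * z)) \<longlongrightarrow> l) (at_left (1::real)) \<and> norm l = 1"
    using inner by (simp add: inner_function_def)
  then show ?thesis
  proof eventually_elim
    case (elim z)
    then obtain l where l: "((\<lambda>r. u (of_real r * z)) \<longlongrightarrow> l) (at_left (1::real))" "norm l = 1"
      by blast
    have lim: "(\<lambda>n. u (of_real (radius n) * z)) \<longlonglongrightarrow> l"
      by (rule filterlim_compose[OF l(1) filterlim_radius])
    moreover have "boundary_fun u z = l"
      unfolding boundary_fun_def by (rule tendsto_Lim[OF _ l(1)]) simp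
    ultimately show ?case
      using l(2) by (simp add: inner_bdry_def limI[OF lim])
  qed
qed

text \<open>For each dilation this is the mean value property; boundedness of \<open>u\<close>
  allows the radii to tend to 1 under the integral. It ties the value \<open>u 0\<close> inside the
  disk to the boundary function and says that the latter has no negative frequencies.\<close>

lemma integral_inner_bdry:
  "(\<integral>z. inner_bdry u z * z ^ k \<partial>circle_measure) = (if k = 0 then u 0 else 0)"
proof -
  obtain B where B: "\<And>w. w \<in> ball 0 1 \<Longrightarrow> norm (u w) \<le> B"
    using inner unfolding inner_function_def bounded_iff by blast
  have "(\<lambda>n. \<integral>z. u (of_real (radius n) * z) * z ^ k \<partial>circle_measure) \<longlonglongrightarrow>
      (\<integral>z. inner_bdry u z * z ^ k \<partial>circle_measure)"
  proof (rule integral_dominated_convergence[where w = "\<lambda>_. B"])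
    note [measurable] = measurable_inner_bdry measurable_dilation measurable_ident_circle
    show "(\<lambda>z. inner_bdry u z * z ^ k) \<in> borel_measurable circle_measure"
      "\<And>n. (\<lambda>z. u (of_real (radius n) * z) * z ^ k) \<in> borel_measurable circle_measure"
      by measurable
    show "AE z in circle_measure. (\<lambda>n. u (of_real (radius n) * z) * z ^ k) \<longlonglongrightarrow> inner_bdry u z * z ^ k"
      using AE_inner_bdry by eventually_elim (intro tendsto_intros, simp)
    show "AE z in circle_measure. norm (u (of_real (radius n) * z) * z ^ k) \<le> B" for n
    proof (rule AE_I2)
      fix z assume "z \<in> space circle_measure"
      then have "norm z = 1" by (simp add: space_circle_measure)
      then show "norm (u (of_real (radius n) * z) * z ^ k) \<le> B"
        using B[OF radius_times_sphere[of z n]] by (simp add: norm_mult norm_power)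
    qed
  qed simp
  moreover have "(\<integral>z. u (of_real (radius n) * z) * z ^ k \<partial>circle_measure) = (if k = 0 then u 0 else 0)" for n
  proof -
    have "(\<lambda>z. u (of_real (radius n) * z) * z ^ k) holomorphic_on cball 0 1"
      by (intro holomorphic_on_mult holomorphic_dilation holomorphic_on_power holomorphic_on_ident)
    from integral_circle_holomorphic[OF this] show ?thesis by (simp add: zero_power)
  qed
  ultimately show ?thesis by (simp add: LIMSEQ_const_iff)
qed

lemma is_product_boundary_iff: "is_product (boundary_fun u) h g \<longleftrightarrow> g = mult_op (inner_bdry u) h"
proof -
  have "is_product (boundary_fun u) h g \<longleftrightarrow>
      (AE z in circle_measure. rep_L2 g z = boundary_fun u z * rep_L2 h z)"
    by (simp add: is_product_def)
  also have "\<dots> \<longleftrightarrow> (AE z in circle_measure. rep_L2 g z = rep_L2 (mult_op (inner_bdry u) h) z)"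
  proof (rule eventually_subst)
    show "AE z in circle_measure. (rep_L2 g z = boundary_fun u z * rep_L2 h z) =
        (rep_L2 g z = rep_L2 (mult_op (inner_bdry u) h) z)"
      using AE_inner_bdry rep_mult_op[OF multiplier_inner_bdry, of h]
      by eventually_elim simp
  qed
  finally show ?thesis by (simp add: L2_eq_iff)
qed

lemma inner_times_hardy2_eq: "inner_times_hardy2 u = mult_op (inner_bdry u) ` hardy2"
  by (auto simp: inner_times_hardy2_def is_product_boundary_iff)

lemma inner_bdry_cnj_cancel: "cnj (inner_bdry u z) * inner_bdry u z = 1" "inner_bdry u z * cnj (inner_bdry u z) = 1"
  using complex_norm_square[of "inner_bdry u z"] by (simp_all add: mult.commute)

lemma mult_inner_bdry_cancel [simp]:
  "mult_op (\<lambda>z. cnj (inner_bdry u z)) (mult_op (inner_bdry u) f) = f"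
  "mult_op (inner_bdry u) (mult_op (\<lambda>z. cnj (inner_bdry u z)) f) = f"
  by (simp_all add: mult_op_mult_op multiplier_inner_bdry inner_bdry_cnj_cancel mult_op_const)

lemma cinner_mult_inner_bdry [simp]:
  "cinner_L2 (mult_op (inner_bdry u) f) (mult_op (inner_bdry u) g) = cinner_L2 f g"
  by (simp add: cinner_mult_op_right multiplier_inner_bdry)

text \<open>The conjugate of \<open>u\<close> has frequencies at most 0 and constant term
  \<open>cnj (u 0)\<close>; multiplying by \<open>z powi n\<close> shifts this to frequencies at
  most \<open>n\<close>. For \<open>k \<ge> n\<close> the integrand is the conjugate of
  \<open>u\<close> times a nonnegative power of \<open>z\<close>.\<close>

lemma fourier_coeff_cnj_inner_bdry:
  assumes "k \<ge> n"
  shows "fourier_coeff (mult_op (\<lambda>z. cnj (inner_bdry u z)) (trig n)) k = (if k = n then cnj (u 0) else 0)"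
proof -
  have "fourier_coeff (mult_op (\<lambda>z. cnj (inner_bdry u z)) (trig n)) k =
      (\<integral>z. cnj (inner_bdry u z) * z powi (n - k) \<partial>circle_measure)"
    unfolding fourier_coeff_eq_cinner by (intro cinner_mult_op_trig multiplier_cnj multiplier_inner_bdry)
  also have "\<dots> = (\<integral>z. cnj (inner_bdry u z * z ^ nat (k - n)) \<partial>circle_measure)"
  proof (rule Bochner_Integration.integral_cong)
    fix z assume "z \<in> space circle_measure"
    then have "norm z = 1" by (simp add: space_circle_measure)
    then have "z powi (n - k) = cnj (z powi (k - n))"
      using cnj_powi[of z "k - n"] by simp
    then show "cnj (inner_bdry u z) * z powi (n - k) = cnj (inner_bdry u z * z ^ nat (k - n))"
      using assms by (simp add: power_int_def)
  qed simp
  also have "\<dots> = cnj (\<integral>z. inner_bdry u z * z ^ nat (k - n) \<partial>circle_measure)"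
    by (rule Bochner_Integration.integral_cnj)
  finally show ?thesis using assms by (simp add: integral_inner_bdry)
qed

end

abbreviation inner_mult :: "(complex \<Rightarrow> complex) \<Rightarrow> L2 \<Rightarrow> L2" where
  "inner_mult u \<equiv> mult_op (inner_bdry u)"

section \<open>The orthogonal complement of the model space\<close>

lemma hardy2_closed:
  "0 \<in> hardy2" "f \<in> hardy2 \<Longrightarrow> g \<in> hardy2 \<Longrightarrow> f + g \<in> hardy2"
  "f \<in> hardy2 \<Longrightarrow> g \<in> hardy2 \<Longrightarrow> f - g \<in> hardy2" "f \<in> hardy2 \<Longrightarrow> scaleC_L2 c f \<in> hardy2"
  "f \<in> hardy2 \<Longrightarrow> mult_z f \<in> hardy2" "n \<ge> 0 \<Longrightarrow> trig n \<in> hardy2"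
  by (auto simp: hardy2_def fourier_coeff_add fourier_coeff_diff fourier_coeff_scaleC
      fourier_coeff_mult_z fourier_coeff_trig fourier_coeff_eq_cinner[of 0])

lemma conj_hardy2_closed:
  "0 \<in> conj_hardy2" "f \<in> conj_hardy2 \<Longrightarrow> g \<in> conj_hardy2 \<Longrightarrow> f + g \<in> conj_hardy2"
  "f \<in> conj_hardy2 \<Longrightarrow> g \<in> conj_hardy2 \<Longrightarrow> f - g \<in> conj_hardy2"
  "f \<in> conj_hardy2 \<Longrightarrow> scaleC_L2 c f \<in> conj_hardy2" "n < 0 \<Longrightarrow> trig n \<in> conj_hardy2"
  by (auto simp: conj_hardy2_def fourier_coeff_add fourier_coeff_diff fourier_coeff_scaleC
      fourier_coeff_trig fourier_coeff_eq_cinner[of 0])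

text \<open>Multiplication by \<open>z\<close> raises frequencies by one, so only the term at
  frequency -1 leaves the space; it lands on the constants.\<close>

lemma mult_z_conj_hardy2:
  "g \<in> conj_hardy2 \<Longrightarrow> mult_z g - scaleC_L2 (fourier_coeff g (-1)) (trig 0) \<in> conj_hardy2"
  by (auto simp: conj_hardy2_def fourier_coeff_diff fourier_coeff_scaleC fourier_coeff_mult_z fourier_coeff_trig)

context
  fixes u :: "complex \<Rightarrow> complex"
  assumes inner: "inner_function u"
begin

lemmas [simp] = multiplier_inner_bdry[OF inner]

lemma fourier_coeff_inner_mult:
  "fourier_coeff (inner_mult u h) n = cinner_L2 h (mult_op (\<lambda>z. cnj (inner_bdry u z)) (trig n))"
  by (simp add: fourier_coeff_eq_cinner cinner_mult_op_right)

text \<open>Moving \<open>u\<close> to the other side pairs \<open>h\<close> with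
  \<open>cnj u\<close> times \<open>z powi n\<close>, which has only negative frequencies when
  \<open>n < 0\<close>.\<close>

lemma inner_mult_hardy2:
  assumes "h \<in> hardy2"
  shows "inner_mult u h \<in> hardy2"
proof -
  have "fourier_coeff (inner_mult u h) n = 0" if "n < 0" for n
    unfolding fourier_coeff_inner_mult
    by (rule cinner_hardy2_conj_hardy2[OF assms])
       (use that in \<open>simp add: conj_hardy2_def fourier_coeff_cnj_inner_bdry[OF inner]\<close>)
  then show ?thesis by (simp add: hardy2_def)
qed

text \<open>Constant terms multiply, as they would for values at 0: the conjugate of
  \<open>u\<close> differs from the constant \<open>cnj (u 0)\<close> by an element of
  \<open>conj_hardy2\<close>, to which \<open>h\<close> is orthogonal.\<close>

lemma fourier_coeff_inner_mult_0:
  assumes "h \<in> hardy2"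
  shows "fourier_coeff (inner_mult u h) 0 = u 0 * fourier_coeff h 0"
proof -
  let ?t = "mult_op (\<lambda>z. cnj (inner_bdry u z)) (trig 0)"
  have "?t - scaleC_L2 (cnj (u 0)) (trig 0) \<in> conj_hardy2"
    by (simp add: conj_hardy2_def fourier_coeff_diff fourier_coeff_scaleC fourier_coeff_trig
        fourier_coeff_cnj_inner_bdry[OF inner])
  then have "cinner_L2 h (?t - scaleC_L2 (cnj (u 0)) (trig 0)) = 0"
    by (rule cinner_hardy2_conj_hardy2[OF assms])
  then show ?thesis
    unfolding fourier_coeff_inner_mult
    by (simp add: cinner_diff_right cinner_scaleC_right fourier_coeff_eq_cinner)
qed

text \<open>The number \<open>u 0\<close> is the inner product of the unit vectors \<open>u\<close>
  and 1, which replaces an appeal to the maximum principle.\<close>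

lemma norm_inner_at_0_le: "norm (u 0) \<le> 1"
proof -
  have "norm (u 0) = norm (cinner_L2 (inner_mult u (trig 0)) (trig 0))"
    using fourier_coeff_inner_mult_0[of "trig 0"] by (simp add: hardy2_closed fourier_coeff_trig fourier_coeff_eq_cinner cinner_trig)
  also have "\<dots> \<le> norm (inner_mult u (trig 0)) * norm (trig 0)" by (rule norm_cinner_le)
  also have "\<dots> = 1"
    by (simp add: norm_L2_def inner_L2_def cinner_mult_inner_bdry[OF inner] cinner_trig)
  finally show ?thesis .
qed

lemma model_space_iff:
  "k \<in> model_space u \<longleftrightarrow> k \<in> hardy2 \<and> (\<forall>h\<in>hardy2. cinner_L2 k (inner_mult u h) = 0)"
  by (auto simp: model_space_def orth_compl_def inner_times_hardy2_eq[OF inner])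

lemma orth_compl_model_spaceI:
  assumes "h \<in> hardy2" "g \<in> conj_hardy2"
  shows "inner_mult u h + g \<in> orth_compl (model_space u)"
  unfolding orth_compl_def
proof safe
  fix k assume k: "k \<in> model_space u"
  then have "cinner_L2 (inner_mult u h) k = 0"
    using assms by (subst cinner_commute) (simp add: model_space_iff)
  moreover have "cinner_L2 g k = 0"
    using k assms by (simp add: model_space_iff cinner_hardy2_conj_hardy2)
  ultimately show "cinner_L2 (inner_mult u h + g) k = 0" by (simp add: cinner_add_left)
qed

text \<open>The projection of \<open>f1\<close> onto \<open>u H\<^sup>2\<close> is obtained by
  conjugating the Riesz projection with multiplication by \<open>u\<close>; this gives
  \<open>h\<close>. What remains, \<open>f1 - inner_mult u h\<close>, lies in the model space and is
  the difference of two vectors orthogonal to that space, so it is orthogonal to itself.\<close>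

lemma orth_compl_model_spaceE:
  assumes "f \<in> orth_compl (model_space u)"
  obtains h g where "h \<in> hardy2" "g \<in> conj_hardy2" "f = inner_mult u h + g"
proof -
  define f1 where "f1 = riesz_proj f"
  define g where "g = f - f1"
  define a where "a = mult_op (\<lambda>z. cnj (inner_bdry u z)) f1"
  define h where "h = riesz_proj a"
  have H: "f1 \<in> hardy2" "h \<in> hardy2" and G: "g \<in> conj_hardy2" "a - h \<in> conj_hardy2"
    by (simp_all add: f1_def h_def g_def riesz_proj_hardy2 diff_riesz_proj_conj_hardy2)
  have f1: "f1 = inner_mult u a"
    by (simp add: a_def mult_inner_bdry_cancel[OF inner])
  have k: "f1 - inner_mult u h \<in> model_space u"
    unfolding model_space_iff
  proof safe
    show "f1 - inner_mult u h \<in> hardy2" using H by (simp add: hardy2_closed inner_mult_hardy2)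
    fix p assume p: "p \<in> hardy2"
    have "cinner_L2 (f1 - inner_mult u h) (inner_mult u p) = cinner_L2 (inner_mult u (a - h)) (inner_mult u p)"
      by (simp add: f1 mult_op_diff)
    also have "\<dots> = 0"
      using cinner_hardy2_conj_hardy2(2)[OF p G(2)] by (simp add: cinner_mult_inner_bdry[OF inner])
    finally show "cinner_L2 (f1 - inner_mult u h) (inner_mult u p) = 0" .
  qed
  have "cinner_L2 (f - (inner_mult u h + g)) (f1 - inner_mult u h) = 0"
    using assms orth_compl_model_spaceI[OF H(2) G(1)] k
    by (simp add: orth_compl_def cinner_diff_left)
  then have "cinner_L2 (f1 - inner_mult u h) (f1 - inner_mult u h) = 0"
    by (simp add: g_def algebra_simps)
  then have "f1 = inner_mult u h" by (simp add: cinner_self_eq_zero)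
  then have "f = inner_mult u h + g" by (simp add: g_def)
  with H(2) G(1) show ?thesis by (rule that)
qed

text \<open>The only term that leaves its summand is the constant \<open>c\<close> produced by
  \<open>mult_z g\<close>. It splits into \<open>c * cnj (u 0) * u\<close>, which joins the first
  summand, and \<open>k\<close> in the model space, which the operator removes.\<close>

lemma dual_compressed_shift_eq:
  assumes h: "h \<in> hardy2" and g: "g \<in> conj_hardy2"
  defines "c \<equiv> fourier_coeff g (-1)"
  shows "dual_compressed_shift u (inner_mult u h + g) =
    inner_mult u (mult_z h + scaleC_L2 (c * cnj (u 0)) (trig 0)) + (mult_z g - scaleC_L2 c (trig 0))"
proof -
  \<comment> \<open>\<open>k\<close> is \<open>c\<close> times \<open>1 - cnj (u 0) * u\<close>, the
    reproducing kernel of the model space at 0.\<close>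
  define k where "k = scaleC_L2 c (trig 0) - inner_mult u (scaleC_L2 (c * cnj (u 0)) (trig 0))"
  let ?F = "mult_z (inner_mult u h + g)"
  let ?R = "inner_mult u (mult_z h + scaleC_L2 (c * cnj (u 0)) (trig 0)) + (mult_z g - scaleC_L2 c (trig 0))"
  have comm: "mult_z (inner_mult u h) = inner_mult u (mult_z h)"
    by (simp add: mult_z_eq_mult_op mult_op_mult_op mult.commute)
  have Fk: "?F - k = ?R"
    by (simp add: k_def comm mult_op_add mult_z_eq_mult_op mult_op_mult_op mult.commute algebra_simps)
  have R: "?R \<in> orth_compl (model_space u)"
    unfolding c_def
    by (intro orth_compl_model_spaceI hardy2_closed h mult_z_conj_hardy2 g order_refl)
  have k: "k \<in> model_space u"
    unfolding model_space_iff
  proof safe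
    show "k \<in> hardy2"
      unfolding k_def by (intro hardy2_closed inner_mult_hardy2 order_refl)
    fix p assume p: "p \<in> hardy2"
    have "cinner_L2 (trig 0) (inner_mult u p) = cnj (u 0 * fourier_coeff p 0)"
      by (subst cinner_commute) (simp only: fourier_coeff_eq_cinner[symmetric] fourier_coeff_inner_mult_0[OF p])
    moreover have "cinner_L2 (trig 0) p = cnj (fourier_coeff p 0)"
      by (subst cinner_commute) (simp only: fourier_coeff_eq_cinner[symmetric])
    ultimately show "cinner_L2 k (inner_mult u p) = 0"
      by (simp add: k_def cinner_diff_left cinner_scaleC_left cinner_mult_inner_bdry[OF inner])
  qed
  have "orth_proj (model_space u) ?F = k"
    unfolding orth_proj_def
  \<comment> \<open>Two candidates differ by a vector that lies both in the model space and in its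
    complement, so they coincide.\<close>
  proof (rule the_equality)
    show "k \<in> model_space u \<and> ?F - k \<in> orth_compl (model_space u)"
      using k R Fk by simp
    fix k' assume k': "k' \<in> model_space u \<and> ?F - k' \<in> orth_compl (model_space u)"
    have "cinner_L2 ((?F - k) - (?F - k')) (k' - k) = 0"
      using k k' R Fk by (simp add: orth_compl_def cinner_diff_left cinner_diff_right)
    then have "cinner_L2 (k' - k) (k' - k) = 0" by simp
    then show "k' = k" by (simp add: cinner_self_eq_zero)
  qed
  then show ?thesis by (simp add: dual_compressed_shift_def Fk)
qed

end

section \<open>Unitary equivalence\<close>

lemma norm_mult_inner_bdry:
  "inner_function u \<Longrightarrow> norm (inner_mult u f) = norm f"
  by (simp add: norm_L2_def inner_L2_def cinner_mult_inner_bdry)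

lemma norm_mult_z: "norm (mult_z f) = norm f"
proof -
  have "mult_op (\<lambda>z. cnj z * z) f = mult_op (\<lambda>_. 1) f"
    by (rule mult_op_cong) (auto simp: cnj_eq_inverse intro!: left_inverse)
  then have "cinner_L2 (mult_z f) (mult_z f) = cinner_L2 f f"
    by (simp add: mult_z_eq_mult_op cinner_mult_op_right mult_op_mult_op mult_op_const)
  then show ?thesis by (simp add: norm_L2_def inner_L2_def)
qed

lemma norm_add_cinner_zero:
  assumes "cinner_L2 f g = 0"
  shows "(norm (f + g))\<^sup>2 = (norm f)\<^sup>2 + (norm g)\<^sup>2"
  by (rule norm_add_Pythagorean) (use assms in \<open>simp add: orthogonal_def inner_L2_def\<close>)

lemma norm_trig [simp]: "norm (trig n) = 1"
  by (simp add: norm_L2_def inner_L2_def cinner_trig)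

lemma norm_inner_mult_add:
  assumes u: "inner_function u" and "h \<in> hardy2" "g \<in> conj_hardy2"
  shows "(norm (inner_mult u h + g))\<^sup>2 = (norm h)\<^sup>2 + (norm g)\<^sup>2"
  using assms inner_mult_hardy2[OF u, of h]
  by (simp add: norm_add_cinner_zero cinner_hardy2_conj_hardy2 norm_mult_inner_bdry)

text \<open>Multiplication by \<open>z\<close> is isometric, and \<open>mult_z h\<close> has no
  constant term that could interfere with the one added. So only the coefficient \<open>c\<close> of
  \<open>g\<close> at -1 changes its share, from \<open>(norm c)\<^sup>2\<close> to
  \<open>(norm c)\<^sup>2 * (norm (u 0))\<^sup>2\<close>.\<close>

lemma norm_dual_compressed_shift:
  assumes u: "inner_function u" and h: "h \<in> hardy2" and g: "g \<in> conj_hardy2"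
  shows "(norm (dual_compressed_shift u (inner_mult u h + g)))\<^sup>2 =
    (norm h)\<^sup>2 + (norm g)\<^sup>2 - (norm (fourier_coeff g (-1)))\<^sup>2 * (1 - (norm (u 0))\<^sup>2)"
proof -
  define c where "c = fourier_coeff g (-1)"
  let ?h = "mult_z h + scaleC_L2 (c * cnj (u 0)) (trig 0)"
  let ?g = "mult_z g - scaleC_L2 c (trig 0)"
  have "(norm (dual_compressed_shift u (inner_mult u h + g)))\<^sup>2 = (norm ?h)\<^sup>2 + (norm ?g)\<^sup>2"
    unfolding dual_compressed_shift_eq[OF u h g] c_def
    by (intro norm_inner_mult_add u hardy2_closed h mult_z_conj_hardy2 g order_refl)
  moreover have "(norm ?h)\<^sup>2 = (norm h)\<^sup>2 + (norm c)\<^sup>2 * (norm (u 0))\<^sup>2"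
  proof -
    have "cinner_L2 (mult_z h) (trig 0) = 0"
      using h by (simp add: fourier_coeff_eq_cinner[symmetric] fourier_coeff_mult_z hardy2_def)
    then show ?thesis
      by (simp add: norm_add_cinner_zero cinner_scaleC_right norm_mult_z norm_scaleC_L2
          norm_mult power_mult_distrib)
  qed
  moreover have "(norm g)\<^sup>2 = (norm ?g)\<^sup>2 + (norm c)\<^sup>2"
  proof -
    have "fourier_coeff ?g 0 = 0"
      by (simp add: fourier_coeff_diff fourier_coeff_scaleC fourier_coeff_trig fourier_coeff_mult_z c_def)
    then have "cinner_L2 ?g (trig 0) = 0"
      by (simp only: fourier_coeff_eq_cinner)
    then have "(norm (?g + scaleC_L2 c (trig 0)))\<^sup>2 = (norm ?g)\<^sup>2 + (norm c)\<^sup>2"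
      by (simp only: norm_add_cinner_zero cinner_scaleC_right norm_scaleC_L2 norm_trig mult_zero_right mult_1_right)
    then show ?thesis by (simp add: norm_mult_z)
  qed
  ultimately show ?thesis by (simp add: c_def algebra_simps)
qed

text \<open>The loss in the squared norm is largest when the coefficient at -1 carries all of
  \<open>f\<close>; this uses \<open>1 - (norm (u 0))\<^sup>2 \<ge> 0\<close>.\<close>

lemma norm_dual_compressed_shift_ge:
  assumes u: "inner_function u" and f: "f \<in> orth_compl (model_space u)"
  shows "norm (u 0) * norm f \<le> norm (dual_compressed_shift u f)"
proof -
  obtain h g where hg: "h \<in> hardy2" "g \<in> conj_hardy2" "f = inner_mult u h + g"
    using orth_compl_model_spaceE[OF u f] by blast
  define a where "a = (norm (u 0))\<^sup>2"
  have a: "0 \<le> a" "a \<le> 1"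
    using norm_inner_at_0_le[OF u] by (auto simp: a_def power_le_one)
  have "norm (fourier_coeff g (-1)) \<le> norm g"
    using norm_cinner_le[of g "trig (-1)"] by (simp add: fourier_coeff_eq_cinner)
  then have "(norm (fourier_coeff g (-1)))\<^sup>2 \<le> (norm h)\<^sup>2 + (norm g)\<^sup>2"
    by (simp add: power_mono add_increasing)
  then have "(norm (fourier_coeff g (-1)))\<^sup>2 * (1 - a) \<le> ((norm h)\<^sup>2 + (norm g)\<^sup>2) * (1 - a)"
    using a by (intro mult_right_mono) auto
  then have "a * (norm f)\<^sup>2 \<le> (norm (dual_compressed_shift u f))\<^sup>2"
    unfolding hg(3) norm_dual_compressed_shift[OF u hg(1,2)] norm_inner_mult_add[OF u hg(1,2)] a_def
    by (simp add: algebra_simps)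
  then have "(norm (u 0) * norm f)\<^sup>2 \<le> (norm (dual_compressed_shift u f))\<^sup>2"
    by (simp add: a_def power_mult_distrib)
  then show ?thesis by (rule power2_le_imp_le) simp
qed

text \<open>The extremal case \<open>h = 0\<close>, \<open>g = trig (-1)\<close>, showing that the
  lower bound is attained.\<close>

lemma norm_dual_compressed_shift_trig:
  assumes u: "inner_function u"
  shows "trig (-1) \<in> orth_compl (model_space u)"
    and "norm (dual_compressed_shift u (trig (-1))) = norm (u 0)"
proof -
  have 0: "inner_mult u 0 = 0"
    using norm_mult_inner_bdry[OF u, of 0] by simp
  show "trig (-1) \<in> orth_compl (model_space u)"
    using orth_compl_model_spaceI[OF u hardy2_closed(1) conj_hardy2_closed(5), of "-1"] by (simp add: 0)
  have "(norm (dual_compressed_shift u (trig (-1))))\<^sup>2 = (norm (u 0))\<^sup>2"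
    using norm_dual_compressed_shift[OF u hardy2_closed(1) conj_hardy2_closed(5), of "-1"]
    by (simp add: 0 fourier_coeff_trig)
  then show "norm (dual_compressed_shift u (trig (-1))) = norm (u 0)" by simp
qed

text \<open>Each inequality plays the extremal vector of one operator against the lower bound of the
  other: \<open>trig (-1)\<close> is pulled back along \<open>U\<close> for the first and pushed
  forward for the second.\<close>

lemma unitarily_equivalent_norm_le:
  assumes u: "inner_function u" and v: "inner_function v"
    and "unitarily_equivalent
           (orth_compl (model_space u)) (dual_compressed_shift u)
           (orth_compl (model_space v)) (dual_compressed_shift v)"
  shows "norm (u 0) \<le> norm (v 0)" and "norm (v 0) \<le> norm (u 0)"
proof -
  let ?H = "orth_compl (model_space u)" and ?K = "orth_compl (model_space v)"
  obtain U where bij: "bij_betw U ?H ?K"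
    and iso: "\<And>f g. f \<in> ?H \<Longrightarrow> g \<in> ?H \<Longrightarrow> cinner_L2 (U f) (U g) = cinner_L2 f g"
    and comm: "\<And>f. f \<in> ?H \<Longrightarrow> U (dual_compressed_shift u f) = dual_compressed_shift v (U f)"
    using assms(3) unfolding unitarily_equivalent_def unitary_between_def by blast
  have norm: "norm (U f) = norm f" if "f \<in> ?H" for f
    using iso[OF that that] by (simp add: norm_L2_def inner_L2_def)
  \<comment> \<open>Invariance of \<open>?H\<close> is required because \<open>U\<close> is
    isometric only there, and it is applied to the image of \<open>f\<close>.\<close>
  have D: "dual_compressed_shift u f \<in> ?H" if f: "f \<in> ?H" for f
  proof -
    obtain h g where hg: "h \<in> hardy2" "g \<in> conj_hardy2" "f = inner_mult u h + g"
      using orth_compl_model_spaceE[OF u f] .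
    show "dual_compressed_shift u f \<in> ?H"
      unfolding hg(3) dual_compressed_shift_eq[OF u hg(1,2)]
      by (intro orth_compl_model_spaceI u hardy2_closed hg mult_z_conj_hardy2 order_refl)
  qed
  have normD: "norm (dual_compressed_shift v (U f)) = norm (dual_compressed_shift u f)" if "f \<in> ?H" for f
    using norm[OF D[OF that]] comm[OF that] by simp
  note tu = norm_dual_compressed_shift_trig[OF u] and tv = norm_dual_compressed_shift_trig[OF v]
  obtain f where f: "f \<in> ?H" "U f = trig (-1)"
    using tv(1) bij by (metis bij_betw_imp_surj_on imageE)
  have "norm f = 1"
    using norm[OF f(1)] by (simp add: f(2))
  then show "norm (u 0) \<le> norm (v 0)"
    using norm_dual_compressed_shift_ge[OF u f(1)] normD[OF f(1)] by (simp add: f(2) tv(2))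
  have "U (trig (-1)) \<in> ?K" "norm (U (trig (-1))) = 1"
    using bij tu(1) norm[OF tu(1)] by (auto dest: bij_betwE)
  then show "norm (v 0) \<le> norm (u 0)"
    using norm_dual_compressed_shift_ge[OF v, of "U (trig (-1))"] normD[OF tu(1)] tu(2) by simp
qed

section \<open>An explicit unitary for the converse\<close>

text \<open>The map \<open>u h + g \<mapsto> \<zeta> v h + g\<close> for \<open>h\<close> in \<open>H\<^sup>2\<close> and \<open>g\<close> orthogonal to it.\<close>

definition intertwiner :: "(complex \<Rightarrow> complex) \<Rightarrow> (complex \<Rightarrow> complex) \<Rightarrow> complex \<Rightarrow> L2 \<Rightarrow> L2" where
  "intertwiner u v \<zeta> f =
     inner_mult v (scaleC_L2 \<zeta> (mult_op (\<lambda>z. cnj (inner_bdry u z)) (riesz_proj f)))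
     + (f - riesz_proj f)"

context
  fixes u v :: "complex \<Rightarrow> complex" and \<zeta> :: complex
  assumes u: "inner_function u" and v: "inner_function v" and \<zeta>: "norm \<zeta> = 1"
begin

text \<open>The Riesz projection recovers \<open>inner_mult u h\<close> from the sum, so the map
  acts on the two summands separately.\<close>

lemma intertwiner_eq:
  assumes "h \<in> hardy2" "g \<in> conj_hardy2"
  shows "intertwiner u v \<zeta> (inner_mult u h + g) = inner_mult v (scaleC_L2 \<zeta> h) + g"
proof -
  have "riesz_proj (inner_mult u h + g) = inner_mult u h"
    using assms by (intro riesz_proj_eqI inner_mult_hardy2[OF u])
  then show ?thesis
    by (simp add: intertwiner_def mult_inner_bdry_cancel[OF u])
qed

text \<open>The map is the orthogonal sum of the identity on \<open>conj_hardy2\<close> and the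
  unitary from \<open>u H\<^sup>2\<close> to \<open>v H\<^sup>2\<close> sending \<open>u h\<close>
  to \<open>\<zeta> v h\<close>; injectivity follows by separating the summands with
  \<open>riesz_proj\<close>.\<close>

lemma unitary_between_intertwiner:
  "unitary_between (orth_compl (model_space u)) (orth_compl (model_space v)) (intertwiner u v \<zeta>)"
proof -
  let ?H = "orth_compl (model_space u)" and ?K = "orth_compl (model_space v)"
  let ?U = "intertwiner u v \<zeta>"
  let ?A = "inner_mult u" and ?B = "inner_mult v"
  note [simp] = multiplier_inner_bdry[OF u] multiplier_inner_bdry[OF v]
  have ll: "\<zeta> * cnj \<zeta> = 1" "cnj \<zeta> * \<zeta> = 1"
    using complex_norm_square[of \<zeta>] \<zeta> by (simp_all add: mult.commute)
  have bij: "bij_betw ?U ?H ?K"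
  proof (rule bij_betw_imageI)
    show "inj_on ?U ?H"
    proof (rule inj_onI)
      fix f f' assume "f \<in> ?H" "f' \<in> ?H" and eq: "?U f = ?U f'"
      obtain h g where f: "h \<in> hardy2" "g \<in> conj_hardy2" "f = ?A h + g"
        using orth_compl_model_spaceE[OF u \<open>f \<in> ?H\<close>] .
      obtain h' g' where f': "h' \<in> hardy2" "g' \<in> conj_hardy2" "f' = ?A h' + g'"
        using orth_compl_model_spaceE[OF u \<open>f' \<in> ?H\<close>] .
      have e: "?B (scaleC_L2 \<zeta> h) + g = ?B (scaleC_L2 \<zeta> h') + g'"
        using eq f f' by (simp add: intertwiner_eq)
      then have "riesz_proj (?B (scaleC_L2 \<zeta> h) + g) = riesz_proj (?B (scaleC_L2 \<zeta> h') + g')"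
        by simp
      then have *: "?B (scaleC_L2 \<zeta> h) = ?B (scaleC_L2 \<zeta> h')"
        using f f' by (simp add: riesz_proj_eqI inner_mult_hardy2[OF v] hardy2_closed)
      then have "scaleC_L2 (cnj \<zeta>) (mult_op (\<lambda>z. cnj (inner_bdry v z)) (?B (scaleC_L2 \<zeta> h))) =
          scaleC_L2 (cnj \<zeta>) (mult_op (\<lambda>z. cnj (inner_bdry v z)) (?B (scaleC_L2 \<zeta> h')))"
        by simp
      then have "h = h'"
        by (simp only: mult_inner_bdry_cancel[OF v] scaleC_scaleC ll scaleC_one)
      moreover have "g = g'" using e * by simp
      ultimately show "f = f'" using f f' by simp
    qed
    show "?U ` ?H = ?K"
    proof safe
      fix f assume "f \<in> ?H"
      then obtain h g where f: "h \<in> hardy2" "g \<in> conj_hardy2" "f = ?A h + g"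
        using orth_compl_model_spaceE[OF u] by blast
      then show "?U f \<in> ?K"
        by (simp add: intertwiner_eq orth_compl_model_spaceI[OF v] hardy2_closed)
    next
      fix f assume "f \<in> ?K"
      then obtain h g where f: "h \<in> hardy2" "g \<in> conj_hardy2" "f = ?B h + g"
        using orth_compl_model_spaceE[OF v] by blast
      \<comment> \<open>The inverse has the same shape, with \<open>u\<close> and \<open>v\<close>
        exchanged and \<open>cnj \<zeta>\<close> for \<open>\<zeta>\<close>.\<close>
      have "?U (?A (scaleC_L2 (cnj \<zeta>) h) + g) = f"
        using f by (simp add: intertwiner_eq hardy2_closed ll)
      moreover have "?A (scaleC_L2 (cnj \<zeta>) h) + g \<in> ?H"
        using f by (intro orth_compl_model_spaceI[OF u] hardy2_closed)
      ultimately show "f \<in> ?U ` ?H" by (metis imageI)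
    qed
  qed
  have "?U (f + f') = ?U f + ?U f' \<and> ?U (scaleC_L2 c f) = scaleC_L2 c (?U f) \<and>
      cinner_L2 (?U f) (?U f') = cinner_L2 f f'" if H: "f \<in> ?H" "f' \<in> ?H" for f f' c
  proof -
    obtain h g where f: "h \<in> hardy2" "g \<in> conj_hardy2" "f = ?A h + g"
      using orth_compl_model_spaceE[OF u H(1)] .
    obtain h' g' where f': "h' \<in> hardy2" "g' \<in> conj_hardy2" "f' = ?A h' + g'"
      using orth_compl_model_spaceE[OF u H(2)] .
    have "f + f' = ?A (h + h') + (g + g')"
      by (simp add: f f' mult_op_add algebra_simps)
    then have "?U (f + f') = ?B (scaleC_L2 \<zeta> (h + h')) + (g + g')"
      using f f' by (simp only: intertwiner_eq hardy2_closed conj_hardy2_closed)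
    then have add: "?U (f + f') = ?U f + ?U f'"
      using f f' by (simp add: intertwiner_eq scaleC_add_right mult_op_add)
    have "scaleC_L2 c f = ?A (scaleC_L2 c h) + scaleC_L2 c g"
      by (simp add: f mult_op_scaleC scaleC_add_right)
    then have "?U (scaleC_L2 c f) = ?B (scaleC_L2 \<zeta> (scaleC_L2 c h)) + scaleC_L2 c g"
      using f by (simp only: intertwiner_eq hardy2_closed conj_hardy2_closed)
    then have scale: "?U (scaleC_L2 c f) = scaleC_L2 c (?U f)"
      using f by (simp add: intertwiner_eq scaleC_add_right mult_op_scaleC mult.commute)
    have "cinner_L2 (?U f) (?U f') = cinner_L2 h h' + cinner_L2 g g'"
    proof -
      have "cinner_L2 (?B (scaleC_L2 \<zeta> h)) (?B (scaleC_L2 \<zeta> h')) = cinner_L2 h h'"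
        unfolding cinner_mult_inner_bdry[OF v] cinner_scaleC_left cinner_scaleC_right
        by (simp add: mult.assoc[symmetric] ll)
      then show ?thesis
        using f f' inner_mult_hardy2[OF v, of "scaleC_L2 \<zeta> h"] inner_mult_hardy2[OF v, of "scaleC_L2 \<zeta> h'"]
        by (simp add: intertwiner_eq cinner_add_left cinner_add_right hardy2_closed cinner_hardy2_conj_hardy2)
    qed
    also have "\<dots> = cinner_L2 f f'"
      using f f' inner_mult_hardy2[OF u, of h] inner_mult_hardy2[OF u, of h']
      by (simp add: cinner_mult_inner_bdry[OF u] cinner_add_left cinner_add_right cinner_hardy2_conj_hardy2)
    finally show ?thesis using add scale by simp
  qed
  with bij show ?thesis unfolding unitary_between_def by blast
qed

text \<open>Multiplication by \<open>z\<close> commutes with everything in the map, so the two sides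
  can differ only in the constant added to the \<open>hardy2\<close> component. That constant is
  \<open>c * \<zeta> * cnj (u 0)\<close> on one side and \<open>c * cnj (v 0)\<close> on the
  other.\<close>

lemma intertwiner_dual_compressed_shift:
  assumes "\<zeta> * cnj (u 0) = cnj (v 0)" and "f \<in> orth_compl (model_space u)"
  shows "intertwiner u v \<zeta> (dual_compressed_shift u f) = dual_compressed_shift v (intertwiner u v \<zeta> f)"
proof -
  obtain h g where f: "h \<in> hardy2" "g \<in> conj_hardy2" "f = inner_mult u h + g"
    using orth_compl_model_spaceE[OF u assms(2)] .
  define c where "c = fourier_coeff g (-1)"
  have "scaleC_L2 \<zeta> (mult_z h + scaleC_L2 (c * cnj (u 0)) (trig 0)) =
      mult_z (scaleC_L2 \<zeta> h) + scaleC_L2 (c * (\<zeta> * cnj (u 0))) (trig 0)"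
    by (simp add: scaleC_add_right mult_z_eq_mult_op mult_op_scaleC mult_ac)
  then show ?thesis
    using f by (simp add: dual_compressed_shift_eq[OF u] dual_compressed_shift_eq[OF v] intertwiner_eq
        hardy2_closed mult_z_conj_hardy2 c_def assms(1))
qed

end

theorem theorem4p10:
  fixes u v :: "complex \<Rightarrow> complex"
  assumes "inner_function u" and "inner_function v"
  shows "unitarily_equivalent
           (orth_compl (model_space u)) (dual_compressed_shift u)
           (orth_compl (model_space v)) (dual_compressed_shift v)
         \<longleftrightarrow> norm (u 0) = norm (v 0)"
proof
  assume "unitarily_equivalent
           (orth_compl (model_space u)) (dual_compressed_shift u)
           (orth_compl (model_space v)) (dual_compressed_shift v)"
  then show "norm (u 0) = norm (v 0)"
    using unitarily_equivalent_norm_le[OF assms] by (intro antisym)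
next
  assume eq: "norm (u 0) = norm (v 0)"
  obtain \<zeta> where \<zeta>: "norm \<zeta> = 1" "\<zeta> * cnj (u 0) = cnj (v 0)"
  \<comment> \<open>If \<open>u 0 = 0\<close> then \<open>v 0 = 0\<close> as well and every
    unimodular number works; otherwise the quotient is forced, and it is unimodular by
    \<open>eq\<close>.\<close>
  proof (cases "u 0 = 0")
    case True
    then show ?thesis using eq by (intro that[of 1]) auto
  next
    case False
    then show ?thesis using eq by (intro that[of "cnj (v 0) / cnj (u 0)"]) (auto simp: norm_divide)
  qed
  show "unitarily_equivalent
           (orth_compl (model_space u)) (dual_compressed_shift u)
           (orth_compl (model_space v)) (dual_compressed_shift v)"
    unfolding unitarily_equivalent_def
    using unitary_between_intertwiner[OF assms \<zeta>(1)] intertwiner_dual_compressed_shift[OF assms \<zeta>]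
    by blast
qed

end
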